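(* Let $A\in\mathbb{R}^{n\times n}$ be a balanceable matrix, let $\epsilon>0$, and let $S_1,\dots,S_p$ be a given coloring of $G_A$. Then parallelized Osborne (with respect to $S_1,\dots,S_p$) finds an $\epsilon$-balancing of $A$ after $K=O\big(\frac{\log\kappa}{\epsilon}\min\{\frac1\epsilon,d\}\big)$ cycles; precisely, there is an absolute constant $C>0$ such that $\mathbb{D}(e^{u_t})$ $\epsilon$-balances $A$ for some integer $0\le t\le C\frac{\log\kappa}{\epsilon}\min\{\frac1\epsilon,d\}$, where $u_t$ is the vector after $t$ cycles. This amounts to $O(mK)$ total work and $O(pK)$ rounds of parallel computation.
   Context: Throughout $n\ge 2$ and $A\in\mathbb{R}^{n\times n}$ has nonnegative entries and zero diagonal. $G_A$ is the directed graph on $[n]=\{1,\dots,n\}$ with edge set $\{(i,j):A_{ij}\ne0\}$. $A$ is called balanceable if $G_A$ is strongly connected. Parameters: $m$ is the number of nonzero entries of $A$; $\kappa=\big(\sum_{i,j}A_{ij}\big)/\min_{(i,j):A_{ij}\ne0}A_{ij}$; $d$ is the diameter of $G_A$ (the maximum over ordered pairs $(i,j)$ of the length of a shortest directed path from $i$ to $j$). A coloring of $G_A$ is a partition $S_1,\dots,S_p$ of $[n]$ such that within each $S_\ell$ all vertices are pairwise non-adjacent, i.e. $A_{ij}=A_{ji}=0$ for all $i,j\in S_\ell$. For $u\in\mathbb{R}^n$ with coordinates $u^{(1)},\dots,u^{(n)}$, $\mathbb{D}(e^{u})$ is the diagonal matrix with diagonal entries $e^{u^{(1)}},\dots,e^{u^{(n)}}$.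 Let $M(u)=\mathbb{D}(e^u)A\,\mathbb{D}(e^{-u})$, so $M(u)_{ij}=e^{u^{(i)}-u^{(j)}}A_{ij}$; let $r_j(u)=\sum_i M(u)_{ji}$ and $c_j(u)=\sum_i M(u)_{ij}$. $\mathbb{D}(e^u)$ $\epsilon$-balances $A$ if $\sum_{j=1}^n|r_j(u)-c_j(u)|\le\epsilon\sum_{i,j}M(u)_{ij}$. Parallelized Osborne: set $u_0=\mathbf 0$. In cycle $k=0,1,2,\dots$, start from $u=u_k$ and, for $\ell=1,\dots,p$ in this order, simultaneously for all $j\in S_\ell$ replace the $j$-th coordinate of the current vector $u$ by $u^{(j)}+\tfrac12\log c_j(u)-\tfrac12\log r_j(u)$ (with $r_j,c_j$ evaluated at the vector $u$ before this block update), leaving the coordinates outside $S_\ell$ unchanged; the vector at the end of the cycle is $u_{k+1}$. The concurrent update of one block $S_\ell$ is one synchronization round of parallel computation; total work counts all arithmetic operations in the exact real-number model (arithmetic operations and elementary functions at unit cost), with $A$ accessed through its nonzero entries. *)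

theory Defs
  imports
    Complex_Main
    "HOL-Library.Disjoint_Sets"
    "HOL-Library.State_Monad"
    "Graph_Theory.Graph_Theory"
    "Jordan_Normal_Form.Matrix"
begin

section \<open>The digraph of a matrix\<close>

text \<open>The index set $[n]$ is rendered as \<open>{0..<n}\<close>.\<close>

definition nonzero_entries :: "real mat \<Rightarrow> (nat \<times> nat) set" where
  "nonzero_entries A = {(i, j). i < dim_row A \<and> j < dim_col A \<and> A $$ (i, j) \<noteq> 0}"

definition mat_graph :: "real mat \<Rightarrow> nat pair_pre_digraph" where
  "mat_graph A = \<lparr> pverts = {0..<dim_row A}, parcs = nonzero_entries A \<rparr>"

definition balanceable :: "real mat \<Rightarrow> bool" where
  "balanceable A \<longleftrightarrow> strongly_connected (with_proj (mat_graph A))"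

definition graph_dist :: "('a, 'b) pre_digraph \<Rightarrow> 'a \<Rightarrow> 'a \<Rightarrow> nat" where
  "graph_dist G u v = (LEAST k. \<exists>p. pre_digraph.apath G u p v \<and> length p = k)"

definition graph_diameter :: "('a, 'b) pre_digraph \<Rightarrow> nat" where
  "graph_diameter G = Max {graph_dist G u v | u v. u \<in> verts G \<and> v \<in> verts G}"

definition is_coloring :: "nat set list \<Rightarrow> real mat \<Rightarrow> bool" where
  "is_coloring Ss A \<longleftrightarrow>
     distinct Ss \<and> partition_on {0..<dim_row A} (set Ss) \<and>
     (\<forall>S \<in> set Ss. \<forall>i \<in> S. \<forall>j \<in> S. A $$ (i, j) = 0 \<and> A $$ (j, i) = 0)"

definition kappa :: "real mat \<Rightarrow> real" where
  "kappa A = sum_mat A / Min {A $$ (i, j) | i j. (i, j) \<in> nonzero_entries A}"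


section \<open>Matrix balancing and parallelized Osborne\<close>

definition scaled :: "real mat \<Rightarrow> real vec \<Rightarrow> real mat" where
  "scaled A u = mat_diag (dim_row A) (\<lambda>i. exp (u $ i)) * A
                * mat_diag (dim_row A) (\<lambda>i. exp (- u $ i))"

definition row_sum :: "real mat \<Rightarrow> real vec \<Rightarrow> nat \<Rightarrow> real" where
  "row_sum A u j = (\<Sum>i<dim_row A. scaled A u $$ (j, i))"

definition col_sum :: "real mat \<Rightarrow> real vec \<Rightarrow> nat \<Rightarrow> real" where
  "col_sum A u j = (\<Sum>i<dim_row A. scaled A u $$ (i, j))"

definition eps_balances :: "real \<Rightarrow> real vec \<Rightarrow> real mat \<Rightarrow> bool" where
  "eps_balances \<epsilon> u A \<longleftrightarrow>
     (\<Sum>j<dim_row A. \<bar>row_sum A u j - col_sum A u j\<bar>) \<le> \<epsilon> * sum_mat (scaled A u)"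

definition block_update :: "real mat \<Rightarrow> nat set \<Rightarrow> real vec \<Rightarrow> real vec" where
  "block_update A S u = vec (dim_row A) (\<lambda>j.
     if j \<in> S then u $ j + ln (col_sum A u j) / 2 - ln (row_sum A u j) / 2 else u $ j)"

definition osborne_cycle :: "real mat \<Rightarrow> nat set list \<Rightarrow> real vec \<Rightarrow> real vec" where
  "osborne_cycle A Ss u = fold (block_update A) Ss u"

definition osborne :: "real mat \<Rightarrow> nat set list \<Rightarrow> nat \<Rightarrow> real vec" where
  "osborne A Ss t = (osborne_cycle A Ss ^^ t) (0\<^sub>v (dim_row A))"


section \<open>Cost of parallelized Osborne in the exact real-number model\<close>

text \<open>
  A computation threads two counters: the number of real operations performed so far
  and the number of synchronization rounds entered so far.  All real arithmetic of the
  algorithm below goes through the unit-cost primitives; storing values, reading them and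
  list traversal are free.
\<close>

type_synonym 'a counted = "(nat \<times> nat, 'a) state"

definition charge :: "real \<Rightarrow> real counted" where
  "charge x = State (\<lambda>(work, rounds). (x, (Suc work, rounds)))"

definition add_c :: "real \<Rightarrow> real \<Rightarrow> real counted" where "add_c x y = charge (x + y)"
definition sub_c :: "real \<Rightarrow> real \<Rightarrow> real counted" where "sub_c x y = charge (x - y)"
definition mul_c :: "real \<Rightarrow> real \<Rightarrow> real counted" where "mul_c x y = charge (x * y)"
definition div_c :: "real \<Rightarrow> real \<Rightarrow> real counted" where "div_c x y = charge (x / y)"
definition exp_c :: "real \<Rightarrow> real counted" where "exp_c x = charge (exp x)"
definition ln_c :: "real \<Rightarrow> real counted" where "ln_c x = charge (ln x)"

definition new_round :: "unit counted" where
  "new_round = State (\<lambda>(work, rounds). ((), (work, Suc rounds)))"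

type_synonym entry = "nat \<times> nat \<times> real"

text \<open>
  The input format: for each index, the nonzero entries \<open>(i, j, A\<^sub>i\<^sub>j)\<close> of that row
  and of that column.  The program has no other access to the matrix.
\<close>

definition row_entries :: "real mat \<Rightarrow> nat \<Rightarrow> entry list" where
  "row_entries A j = [(j, i, A $$ (j, i)). i \<leftarrow> [0..<dim_col A], A $$ (j, i) \<noteq> 0]"

definition col_entries :: "real mat \<Rightarrow> nat \<Rightarrow> entry list" where
  "col_entries A j = [(i, j, A $$ (i, j)). i \<leftarrow> [0..<dim_row A], A $$ (i, j) \<noteq> 0]"

fun scaled_sum_c :: "real vec \<Rightarrow> entry list \<Rightarrow> real counted" where
  "scaled_sum_c u [] = State_Monad.return 0"
| "scaled_sum_c u ((i, j, a) # es) = do {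
     d \<leftarrow> sub_c (u $ i) (u $ j);
     f \<leftarrow> exp_c d;
     x \<leftarrow> mul_c f a;
     s \<leftarrow> scaled_sum_c u es;
     add_c x s
   }"

definition new_coord_c ::
  "(nat \<Rightarrow> entry list) \<Rightarrow> (nat \<Rightarrow> entry list) \<Rightarrow> real vec \<Rightarrow> nat \<Rightarrow> real counted" where
  "new_coord_c row_es col_es u j = do {
     r \<leftarrow> scaled_sum_c u (row_es j);
     c \<leftarrow> scaled_sum_c u (col_es j);
     lc \<leftarrow> ln_c c;
     lr \<leftarrow> ln_c r;
     hc \<leftarrow> div_c lc 2;
     hr \<leftarrow> div_c lr 2;
     x \<leftarrow> add_c (u $ j) hc;
     sub_c x hr
   }"

fun new_coords_c ::
  "(nat \<Rightarrow> entry list) \<Rightarrow> (nat \<Rightarrow> entry list) \<Rightarrow> real vec \<Rightarrow> nat list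
   \<Rightarrow> (nat \<times> real) list counted" where
  "new_coords_c row_es col_es u [] = State_Monad.return []"
| "new_coords_c row_es col_es u (j # js) = do {
     x \<leftarrow> new_coord_c row_es col_es u j;
     xs \<leftarrow> new_coords_c row_es col_es u js;
     State_Monad.return ((j, x) # xs)
   }"

definition block_round_c ::
  "(nat \<Rightarrow> entry list) \<Rightarrow> (nat \<Rightarrow> entry list) \<Rightarrow> nat list \<Rightarrow> real vec \<Rightarrow> real vec counted" where
  "block_round_c row_es col_es js u = do {
     _ \<leftarrow> new_round;
     xs \<leftarrow> new_coords_c row_es col_es u js;
     State_Monad.return (vec (dim_vec u) (\<lambda>i. case map_of xs i of None \<Rightarrow> u $ i | Some x \<Rightarrow> x))
   }"

fun cycle_c ::
  "(nat \<Rightarrow> entry list) \<Rightarrow> (nat \<Rightarrow> entry list) \<Rightarrow> nat list list \<Rightarrow> real vec \<Rightarrow> real vec counted" where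
  "cycle_c row_es col_es [] u = State_Monad.return u"
| "cycle_c row_es col_es (js # jss) u = do {
     v \<leftarrow> block_round_c row_es col_es js u;
     cycle_c row_es col_es jss v
   }"

fun cycles_c ::
  "nat \<Rightarrow> (nat \<Rightarrow> entry list) \<Rightarrow> (nat \<Rightarrow> entry list) \<Rightarrow> nat list list \<Rightarrow> nat
   \<Rightarrow> real vec counted" where
  "cycles_c n row_es col_es jss 0 = State_Monad.return (0\<^sub>v n)"
| "cycles_c n row_es col_es jss (Suc t) = do {
     u \<leftarrow> cycles_c n row_es col_es jss t;
     cycle_c row_es col_es jss u
   }"

definition parallel_osborne_c :: "real mat \<Rightarrow> nat set list \<Rightarrow> nat \<Rightarrow> real vec counted" where
  "parallel_osborne_c A Ss t =
     cycles_c (dim_row A) (row_entries A) (col_entries A) (map sorted_list_of_set Ss) t"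

end

theory Submission
  imports Defs "HOL-Analysis.Convex"
begin

text \<open>
  Consider \<open>\<Phi>(u) = ln (\<Sum> M(u))\<close>, the logarithm of the total weight of the scaled matrix.  Each
  coordinate update of Osborne's iteration minimises \<open>\<Phi>\<close> in that coordinate, the gradient of \<open>\<Phi>\<close> is
  \<open>(r - c) / \<Sum> M(u)\<close>, and the relative imbalance \<open>e\<close> that has to be brought below \<open>\<epsilon>\<close> is the
  1-norm of this gradient.  Since \<open>\<Phi>\<close> can never fall below the logarithm of the smallest nonzero entry, it
  decreases by at most \<open>ln \<kappa>\<close> over the whole run.

  The heart of the proof is that one cycle with final relative imbalance \<open>e\<close> lowers \<open>\<Phi>\<close> by at least a
  constant times \<open>e^2\<close> (\<open>ln_weight_drop\<close>).  An update of \<open>j\<close> lowers the total weight by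
  \<open>(sqrt r - sqrt c)^2\<close>, where \<open>r\<close> and \<open>c\<close> are the row and column sums at that moment.  On the other
  hand \<open>j\<close> is balanced right after its update, so its imbalance at the end of the cycle is caused by
  updates of its neighbours, and in total the final imbalance is at most the sum of the \<open>\<bar>r - c\<bar>\<close>
  (\<open>imbalance_after_le\<close>).  Cauchy-Schwarz compares the two sums.  The remaining factor is the sum of all
  \<open>r + c\<close>, which mixes entries from different times of the cycle; \<open>half_total_le\<close> bounds it by a multiple
  of the initial weight.

  A decrease of order \<open>\<epsilon>^2\<close> per cycle gives the bound \<open>ln \<kappa> / \<epsilon>^2\<close>.  For the bound with the diameter
  \<open>d\<close>, all potentials of the run vary by at most \<open>d * ln \<kappa>\<close> (\<open>sublevel_spread\<close>), and convexity
  of \<open>\<Phi>\<close> shows that its gap to any later value is \<open>O(d * ln \<kappa> * e)\<close> (\<open>ln_weight_gap_le\<close>).  So the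
  decrease in a cycle is also at least quadratic in the remaining gap, and the two facts together give
  \<open>O(d * ln \<kappa> / \<epsilon>)\<close> cycles (\<open>early_small_error_of_gap_bound\<close>).

  A coloring enters only through the absence of arcs inside a class: this makes the concurrent
  updates of a class independent of each other.  The operation count is exact, namely
  \<open>8 * m + 6 * n\<close> operations and one round per class in each cycle, and \<open>n \<le> m\<close> by strong connectivity.
\<close>

section \<open>Weighted digraphs and potentials\<close>

text \<open>
  A matrix with nonnegative entries is treated as a weighted digraph: \<open>a i j\<close> is the weight of the
  arc from \<open>i\<close> to \<open>j\<close>, and the scaling by \<open>exp u\<close> replaces it by \<open>a i j * exp (u i - u j)\<close>.
\<close>

definition entry :: "('v \<Rightarrow> 'v \<Rightarrow> real) \<Rightarrow> ('v \<Rightarrow> real) \<Rightarrow> 'v \<Rightarrow> 'v \<Rightarrow> real" where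
  "entry a u i j = a i j * exp (u i - u j)"

definition weight :: "'v set \<Rightarrow> ('v \<Rightarrow> 'v \<Rightarrow> real) \<Rightarrow> ('v \<Rightarrow> real) \<Rightarrow> real" where
  "weight V a u = (\<Sum>i\<in>V. \<Sum>j\<in>V. entry a u i j)"

definition outflow :: "'v set \<Rightarrow> ('v \<Rightarrow> 'v \<Rightarrow> real) \<Rightarrow> ('v \<Rightarrow> real) \<Rightarrow> 'v \<Rightarrow> real" where
  "outflow V a u j = (\<Sum>i\<in>V. entry a u j i)"

definition inflow :: "'v set \<Rightarrow> ('v \<Rightarrow> 'v \<Rightarrow> real) \<Rightarrow> ('v \<Rightarrow> real) \<Rightarrow> 'v \<Rightarrow> real" where
  "inflow V a u j = (\<Sum>i\<in>V. entry a u i j)"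

definition imbalance :: "'v set \<Rightarrow> ('v \<Rightarrow> 'v \<Rightarrow> real) \<Rightarrow> ('v \<Rightarrow> real) \<Rightarrow> real" where
  "imbalance V a u = (\<Sum>j\<in>V. \<bar>outflow V a u j - inflow V a u j\<bar>)"

lemma inflow_cong: "(\<And>i. i \<in> V \<Longrightarrow> u i = v i) \<Longrightarrow> j \<in> V \<Longrightarrow> inflow V a u j = inflow V a v j"
  unfolding inflow_def entry_def by (intro sum.cong) auto

lemma outflow_cong: "(\<And>i. i \<in> V \<Longrightarrow> u i = v i) \<Longrightarrow> j \<in> V \<Longrightarrow> outflow V a u j = outflow V a v j"
  unfolding outflow_def entry_def by (intro sum.cong) auto

text \<open>
  Each arc joins vertices of different classes, so it can be charged either to the endpoint that is
  updated later or to the one that is updated earlier.  The two lemmas below perform this regrouping.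
\<close>

lemma sum_pairs_by_later:
  fixes X :: "'v \<Rightarrow> 'v \<Rightarrow> real" and b :: "'v \<Rightarrow> nat"
  assumes "\<And>i j. i \<in> V \<Longrightarrow> j \<in> V \<Longrightarrow> b i = b j \<Longrightarrow> X i j = 0"
  shows "(\<Sum>j\<in>V. \<Sum>i\<in>V. if b i < b j then X j i + X i j else 0) = (\<Sum>i\<in>V. \<Sum>j\<in>V. X i j)"
proof -
  have "(\<Sum>j\<in>V. \<Sum>i\<in>V. if b i < b j then X j i + X i j else 0)
      = (\<Sum>j\<in>V. \<Sum>i\<in>V. if b i < b j then X j i else 0)
      + (\<Sum>j\<in>V. \<Sum>i\<in>V. if b i < b j then X i j else 0)"
    unfolding sum.distrib[symmetric] by (intro sum.cong refl) simp
  also have "(\<Sum>j\<in>V. \<Sum>i\<in>V. if b i < b j then X i j else 0)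
      = (\<Sum>j\<in>V. \<Sum>i\<in>V. if b j < b i then X j i else 0)"
    by (rule sum.swap)
  also have "(\<Sum>j\<in>V. \<Sum>i\<in>V. if b i < b j then X j i else 0) + \<dots> = (\<Sum>j\<in>V. \<Sum>i\<in>V. X j i)"
    unfolding sum.distrib[symmetric]
  proof (intro sum.cong refl)
    fix i j assume "j \<in> V" "i \<in> V"
    then show "(if b i < b j then X j i else 0) + (if b j < b i then X j i else 0) = X j i"
      using assms[of j i] by (cases "b i" "b j" rule: linorder_cases) auto
  qed
  finally show ?thesis .
qed

lemma sum_pairs_by_earlier:
  fixes X :: "'v \<Rightarrow> 'v \<Rightarrow> real" and b :: "'v \<Rightarrow> nat"
  assumes "\<And>i j. i \<in> V \<Longrightarrow> j \<in> V \<Longrightarrow> b i = b j \<Longrightarrow> X i j = 0"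
  shows "(\<Sum>j\<in>V. \<Sum>i\<in>V. if b i < b j then 0 else X j i + X i j) = (\<Sum>i\<in>V. \<Sum>j\<in>V. X i j)"
proof -
  have "(\<Sum>j\<in>V. \<Sum>i\<in>V. if b i < b j then 0 else X j i + X i j)
      + (\<Sum>j\<in>V. \<Sum>i\<in>V. if b i < b j then X j i + X i j else 0)
      = (\<Sum>j\<in>V. \<Sum>i\<in>V. X j i) + (\<Sum>j\<in>V. \<Sum>i\<in>V. X i j)"
    unfolding sum.distrib[symmetric] by (intro sum.cong refl) auto
  also have "(\<Sum>j\<in>V. \<Sum>i\<in>V. X i j) = (\<Sum>i\<in>V. \<Sum>j\<in>V. X i j)"
    by (rule sum.swap)
  finally show ?thesis
    using sum_pairs_by_later[of V b X] assms by simp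
qed

section \<open>One cycle over a coloring\<close>

text \<open>
  The potential seen by vertex \<open>j\<close> when its turn comes, if \<open>u\<close> is the potential before the cycle and
  \<open>v\<close> the one after it: vertices of earlier classes already carry their new value.
\<close>

definition stage :: "('v \<Rightarrow> nat) \<Rightarrow> ('v \<Rightarrow> real) \<Rightarrow> ('v \<Rightarrow> real) \<Rightarrow> 'v \<Rightarrow> 'v \<Rightarrow> real" where
  "stage b u v j i = (if b i < b j then v i else u i)"

text \<open>
  A full cycle characterised without its intermediate vectors: the new value at \<open>j\<close> is computed from
  \<open>stage b u v j\<close>, as in a Gauss-Seidel iteration.  Vertices of the class of \<open>j\<close> may keep their old
  value in the stage since no arc joins them to \<open>j\<close>; this is why simultaneous updates within a class
  are as good as successive ones.
\<close>

locale osborne_sweep =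
  fixes V :: "'v set" and a :: "'v \<Rightarrow> 'v \<Rightarrow> real" and b :: "'v \<Rightarrow> nat"
    and u v :: "'v \<Rightarrow> real"
  assumes a_nonneg: "\<And>i j. i \<in> V \<Longrightarrow> j \<in> V \<Longrightarrow> 0 \<le> a i j"
    and independent: "\<And>i j. i \<in> V \<Longrightarrow> j \<in> V \<Longrightarrow> b i = b j \<Longrightarrow> a i j = 0"
    and out_pos: "\<And>j. j \<in> V \<Longrightarrow> 0 < outflow V a (stage b u v j) j"
    and in_pos: "\<And>j. j \<in> V \<Longrightarrow> 0 < inflow V a (stage b u v j) j"
    and update: "\<And>j. j \<in> V \<Longrightarrow>
      v j = u j + ln (inflow V a (stage b u v j) j) / 2 - ln (outflow V a (stage b u v j) j) / 2"
begin

text \<open>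
  During a cycle an arc takes three values: \<open>entry a u\<close> before, \<open>half\<close> once the earlier of its
  endpoints has been updated, and \<open>entry a v\<close> after the later one has been updated.
\<close>

definition half :: "'v \<Rightarrow> 'v \<Rightarrow> real" where
  "half i j = a i j * exp (if b i < b j then v i - u j else u i - v j)"

definition r :: "'v \<Rightarrow> real" where "r j = outflow V a (stage b u v j) j"
definition c :: "'v \<Rightarrow> real" where "c j = inflow V a (stage b u v j) j"

text \<open>
  Updating \<open>j\<close> multiplies its row by \<open>factor j\<close> and divides its column by it, which turns both the row
  sum \<open>r j\<close> and the column sum \<open>c j\<close> into their geometric mean \<open>mean j\<close>.
\<close>

definition factor :: "'v \<Rightarrow> real" where "factor j = exp (v j - u j)"
definition mean :: "'v \<Rightarrow> real" where "mean j = factor j * r j"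

abbreviation (input) "pre \<equiv> entry a u"
abbreviation (input) "post \<equiv> entry a v"

lemma factor_pos: "0 < factor j" by (simp add: factor_def)

lemma half_nonneg: "i \<in> V \<Longrightarrow> j \<in> V \<Longrightarrow> 0 \<le> half i j"
  by (simp add: half_def a_nonneg)

lemma pre_nonneg: "i \<in> V \<Longrightarrow> j \<in> V \<Longrightarrow> 0 \<le> pre i j"
  by (simp add: entry_def a_nonneg)

lemma r_eq: "r j = (\<Sum>i\<in>V. if b i < b j then half j i else pre j i)"
  unfolding r_def outflow_def entry_def stage_def half_def by (intro sum.cong refl) auto

lemma c_eq: "c j = (\<Sum>i\<in>V. if b i < b j then half i j else pre i j)"
  unfolding c_def inflow_def entry_def stage_def half_def by (intro sum.cong refl) auto

lemma row_scaled:
  assumes "j \<in> V" "i \<in> V"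
  shows "b i < b j \<Longrightarrow> post j i = factor j * half j i"
    and "\<not> b i < b j \<Longrightarrow> half j i = factor j * pre j i"
proof -
  have factor: "exp (v j - x) = factor j * exp (u j - x)" for x by (simp add: factor_def flip: exp_add)
  show "b i < b j \<Longrightarrow> post j i = factor j * half j i"
    by (simp add: entry_def half_def factor)
  show "\<not> b i < b j \<Longrightarrow> half j i = factor j * pre j i"
    using independent[of j i] assms by (cases "b i = b j") (simp_all add: entry_def half_def factor)
qed

lemma column_scaled:
  assumes "j \<in> V" "i \<in> V"
  shows "b i < b j \<Longrightarrow> post i j = half i j / factor j"
    and "\<not> b i < b j \<Longrightarrow> half i j = pre i j / factor j"
proof -
  have factor: "exp (x - v j) = exp (x - u j) / factor j" for x by (simp add: factor_def flip: exp_diff)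
  show "b i < b j \<Longrightarrow> post i j = half i j / factor j"
    by (simp add: entry_def half_def factor)
  show "\<not> b i < b j \<Longrightarrow> half i j = pre i j / factor j"
    using independent[of i j] assms by (cases "b i = b j") (simp_all add: entry_def half_def factor)
qed

lemma mean_eq_row: "j \<in> V \<Longrightarrow> mean j = (\<Sum>i\<in>V. if b i < b j then post j i else half j i)"
  unfolding mean_def r_eq sum_distrib_left by (intro sum.cong refl) (auto simp: row_scaled)

lemma factor_squared: assumes "j \<in> V" shows "factor j * factor j = c j / r j"
proof -
  have "factor j * factor j = exp (ln (c j) - ln (r j))"
    using update[OF assms] by (simp add: factor_def r_def c_def flip: exp_add)
  then show ?thesis
    using out_pos[OF assms] in_pos[OF assms] by (simp add: exp_diff r_def c_def)
qed

lemma rc_pos: "j \<in> V \<Longrightarrow> 0 < r j" "j \<in> V \<Longrightarrow> 0 < c j"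
  using out_pos in_pos by (auto simp: r_def c_def)

lemma factor_mean: "j \<in> V \<Longrightarrow> factor j * mean j = c j"
  using factor_squared[of j] rc_pos[of j] by (simp add: mean_def field_simps)

lemma mean_squared: "j \<in> V \<Longrightarrow> mean j * mean j = r j * c j"
  using factor_mean[of j] by (simp add: mean_def algebra_simps)

lemma mean_eq_c: "j \<in> V \<Longrightarrow> mean j = c j / factor j"
  using factor_mean[of j] factor_pos[of j] by (simp add: field_simps)

lemma mean_eq_column: "j \<in> V \<Longrightarrow> mean j = (\<Sum>i\<in>V. if b i < b j then post i j else half i j)"
  unfolding mean_eq_c c_eq sum_divide_distrib by (intro sum.cong refl) (auto simp: column_scaled)

lemma mean_le: assumes "j \<in> V" shows "2 * mean j \<le> r j + c j"
proof (rule power2_le_imp_le)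
  show "(2 * mean j)\<^sup>2 \<le> (r j + c j)\<^sup>2"
    using mean_squared[OF assms] zero_le_power2[of "r j - c j"]
    by (simp add: power2_eq_square algebra_simps)
qed (use rc_pos[OF assms] in simp)

lemma abs_mean_diff: assumes "j \<in> V" shows "\<bar>mean j - r j\<bar> + \<bar>mean j - c j\<bar> = \<bar>r j - c j\<bar>"
proof (cases "1 \<le> factor j")
  case True
  have "r j \<le> mean j"
    using mult_right_mono[OF True, of "r j"] rc_pos(1)[OF assms] by (simp add: mean_def)
  moreover have "mean j \<le> c j"
    using mult_right_mono[OF True, of "mean j"] factor_mean[OF assms] calculation rc_pos(1)[OF assms] by simp
  ultimately show ?thesis by simp
next
  case False
  then have "factor j \<le> 1" by simp
  have "mean j \<le> r j"
    using mult_right_mono[OF \<open>factor j \<le> 1\<close>, of "r j"] rc_pos(1)[OF assms] by (simp add: mean_def)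
  moreover have "c j \<le> mean j"
  proof -
    have "0 \<le> mean j" using factor_pos[of j] rc_pos(1)[OF assms] by (simp add: mean_def)
    then show ?thesis
      using mult_right_mono[OF \<open>factor j \<le> 1\<close>, of "mean j"] factor_mean[OF assms] by simp
  qed
  ultimately show ?thesis by simp
qed

definition half_total :: real where "half_total = (\<Sum>i\<in>V. \<Sum>j\<in>V. half i j)"

lemma independent_zero:
  assumes "i \<in> V" "j \<in> V" "b i = b j"
  shows "pre i j = 0" "half i j = 0" "post i j = 0"
  using independent[OF assms] by (auto simp: entry_def half_def)

text \<open>
  When the turn of a vertex comes, its arcs to and from earlier classes have the value \<open>half\<close> and its
  other arcs are untouched; over all vertices every arc is counted once in each of the two states.  Immediately
  after the updates the same holds with the states \<open>half\<close> and final.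
\<close>

lemma sum_before: "(\<Sum>j\<in>V. r j + c j) = half_total + weight V a u"
proof -
  have "(\<Sum>j\<in>V. r j + c j)
    = (\<Sum>j\<in>V. \<Sum>i\<in>V. if b i < b j then half j i + half i j else 0)
    + (\<Sum>j\<in>V. \<Sum>i\<in>V. if b i < b j then 0 else pre j i + pre i j)"
    unfolding r_eq c_eq sum.distrib[symmetric] by (intro sum.cong refl) auto
  then show ?thesis
    using sum_pairs_by_later[of V b half] sum_pairs_by_earlier[of V b pre] independent_zero
    by (simp add: half_total_def weight_def)
qed

lemma sum_after: "(\<Sum>j\<in>V. 2 * mean j) = weight V a v + half_total"
proof -
  have "(\<Sum>j\<in>V. 2 * mean j) = (\<Sum>j\<in>V. (\<Sum>i\<in>V. if b i < b j then post j i else half j i)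
      + (\<Sum>i\<in>V. if b i < b j then post i j else half i j))"
    using mean_eq_row mean_eq_column by (intro sum.cong refl) simp
  also have "\<dots> = (\<Sum>j\<in>V. \<Sum>i\<in>V. if b i < b j then post j i + post i j else 0)
    + (\<Sum>j\<in>V. \<Sum>i\<in>V. if b i < b j then 0 else half j i + half i j)"
    unfolding sum.distrib[symmetric] by (intro sum.cong refl) auto
  finally show ?thesis
    using sum_pairs_by_later[of V b post] sum_pairs_by_earlier[of V b half] independent_zero
    by (simp add: half_total_def weight_def)
qed

lemma weight_decreases: "weight V a v \<le> weight V a u"
proof -
  have "(\<Sum>j\<in>V. 2 * mean j) \<le> (\<Sum>j\<in>V. r j + c j)" using mean_le by (rule sum_mono)
  then show ?thesis using sum_before sum_after by simp
qed

text \<open>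
  The intermediate weights could exceed the initial ones, and the monotone decrease of the weight does
  not control them: the values \<open>half\<close> of different arcs occur at different times.  The bound is obtained
  from a self-referential inequality.  The arcs of \<open>j\<close> that become half updated at the turn of \<open>j\<close> have
  row part \<open>rf \<le> r j\<close> and column part \<open>cf \<le> c j\<close>, and with \<open>f = factor j\<close> the inequality
  \<open>f \<le> 1 + f^2 / 4\<close> gives \<open>f * rf \<le> rf + f^2 * r j / 4 = rf + c j / 4\<close>; symmetrically for \<open>cf\<close>.
  Summing over \<open>j\<close> yields \<open>half_total \<le> W + (half_total + W) / 4\<close> with \<open>W\<close> the initial weight, and
  the factor 1/4 in front of \<open>half_total\<close> lets it be absorbed on the left.
\<close>

lemma half_total_le: "half_total \<le> 5 / 3 * weight V a u"
proof -
  have "half_total = (\<Sum>j\<in>V. \<Sum>i\<in>V. if b i < b j then 0 else half j i + half i j)"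
    using sum_pairs_by_earlier[of V b half] independent_zero by (simp add: half_total_def)
  also have "\<dots> \<le> (\<Sum>j\<in>V. (\<Sum>i\<in>V. if b i < b j then 0 else pre j i + pre i j) + (r j + c j) / 4)"
  proof (intro sum_mono)
    fix j assume j: "j \<in> V"
    define rf where "rf = (\<Sum>i\<in>V. if b i < b j then 0 else pre j i)"
    define cf where "cf = (\<Sum>i\<in>V. if b i < b j then 0 else pre i j)"
    have rf: "0 \<le> rf" "rf \<le> r j" and cf: "0 \<le> cf" "cf \<le> c j"
      unfolding rf_def cf_def r_eq c_eq
      using j pre_nonneg half_nonneg by (auto intro!: sum_nonneg sum_mono)
    have quarter: "x \<le> 1 + x * x / 4" for x :: real
      using zero_le_power2[of "x / 2 - 1"] by (simp add: power2_eq_square algebra_simps)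
    have "factor j * rf \<le> (1 + factor j * factor j / 4) * rf"
      using quarter rf by (intro mult_right_mono)
    also have "\<dots> \<le> rf + factor j * factor j / 4 * r j"
      using mult_left_mono[OF rf(2), of "factor j * factor j / 4"] by (simp add: distrib_right)
    also have "\<dots> = rf + c j / 4"
      using factor_squared[OF j] rc_pos[OF j] by simp
    finally have 1: "factor j * rf \<le> rf + c j / 4" .
    have "1 / factor j * cf \<le> (1 + (1 / factor j) * (1 / factor j) / 4) * cf"
      using quarter cf by (intro mult_right_mono)
    also have "\<dots> \<le> cf + (1 / factor j) * (1 / factor j) / 4 * c j"
      using mult_left_mono[OF cf(2), of "(1 / factor j) * (1 / factor j) / 4"]
      by (simp only: distrib_right) simp
    also have "\<dots> = cf + r j / 4"
      using factor_squared[OF j] rc_pos[OF j] by simp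
    finally have 2: "cf / factor j \<le> cf + r j / 4" by simp
    have "(\<Sum>i\<in>V. if b i < b j then 0 else half j i + half i j) = factor j * rf + cf / factor j"
      unfolding rf_def cf_def sum_distrib_left sum_divide_distrib sum.distrib[symmetric]
      using j by (intro sum.cong refl) (simp add: row_scaled column_scaled)
    also have "\<dots> \<le> (rf + cf) + (r j + c j) / 4" using 1 2 by argo
    also have "rf + cf = (\<Sum>i\<in>V. if b i < b j then 0 else pre j i + pre i j)"
      unfolding rf_def cf_def sum.distrib[symmetric] by (intro sum.cong refl) simp
    finally show "(\<Sum>i\<in>V. if b i < b j then 0 else half j i + half i j)
      \<le> (\<Sum>i\<in>V. if b i < b j then 0 else pre j i + pre i j) + (r j + c j) / 4" .
  qed
  also have "\<dots> = weight V a u + (half_total + weight V a u) / 4"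
    using sum_pairs_by_earlier[of V b pre] independent_zero
    unfolding sum.distrib[of _ "\<lambda>j. (r j + c j) / 4"] sum_divide_distrib[symmetric] sum_before
    by (simp add: weight_def)
  finally show ?thesis by argo
qed

text \<open>
  A vertex is perfectly balanced right after its own update.  Its imbalance at the end of the cycle can
  therefore only come from later updates of its neighbours.  Charging these changes to the vertices that
  cause them, an update of \<open>j\<close> moves the arcs at \<open>j\<close> by at most \<open>\<bar>mean j - r j\<bar> + \<bar>mean j - c j\<bar>\<close> in
  total, and this is \<open>\<bar>r j - c j\<bar>\<close> because the mean lies between the two.
\<close>

lemma imbalance_after_le: "imbalance V a v \<le> (\<Sum>j\<in>V. \<bar>r j - c j\<bar>)"
proof -
  \<comment> \<open>the change of an arc at the second of its two updates\<close>
  define Y where "Y i j = \<bar>post i j - half i j\<bar>" for i j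
  have "imbalance V a v \<le> (\<Sum>j\<in>V. \<Sum>i\<in>V. if b i < b j then 0 else Y j i + Y i j)"
    unfolding imbalance_def
  proof (intro sum_mono)
    fix j assume j: "j \<in> V"
    have "outflow V a v j - inflow V a v j
      = (outflow V a v j - mean j) - (inflow V a v j - mean j)" by simp
    also have "outflow V a v j - mean j = (\<Sum>i\<in>V. if b i < b j then 0 else post j i - half j i)"
      unfolding outflow_def mean_eq_row[OF j] sum_subtractf[symmetric] by (intro sum.cong refl) simp
    also have "inflow V a v j - mean j = (\<Sum>i\<in>V. if b i < b j then 0 else post i j - half i j)"
      unfolding inflow_def mean_eq_column[OF j] sum_subtractf[symmetric] by (intro sum.cong refl) simp
    finally have "\<bar>outflow V a v j - inflow V a v j\<bar> = \<bar>\<Sum>i\<in>V.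
        if b i < b j then 0 else (post j i - half j i) - (post i j - half i j)\<bar>"
      unfolding sum_subtractf[symmetric] by (auto intro!: arg_cong[where f = abs] sum.cong)
    also have "\<dots> \<le> (\<Sum>i\<in>V. if b i < b j then 0 else Y j i + Y i j)"
      by (rule order_trans[OF sum_abs]) (auto intro!: sum_mono simp: Y_def)
    finally show "\<bar>outflow V a v j - inflow V a v j\<bar>
      \<le> (\<Sum>i\<in>V. if b i < b j then 0 else Y j i + Y i j)" .
  qed
  also have "\<dots> = (\<Sum>j\<in>V. \<Sum>i\<in>V. if b i < b j then Y j i + Y i j else 0)"
    using sum_pairs_by_earlier[of V b Y] sum_pairs_by_later[of V b Y] independent_zero
    by (simp add: Y_def)
  also have "\<dots> \<le> (\<Sum>j\<in>V. \<bar>r j - c j\<bar>)"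
  proof (intro sum_mono)
    fix j assume j: "j \<in> V"
    have "(\<Sum>i\<in>V. if b i < b j then Y j i + Y i j else 0)
      = (\<Sum>i\<in>V. if b i < b j then Y j i else 0) + (\<Sum>i\<in>V. if b i < b j then Y i j else 0)"
      unfolding sum.distrib[symmetric] by (intro sum.cong refl) simp
    also have "(\<Sum>i\<in>V. if b i < b j then Y j i else 0) \<le> \<bar>factor j - 1\<bar> * r j"
      unfolding r_eq sum_distrib_left
    proof (intro sum_mono)
      fix i assume i: "i \<in> V"
      have "Y j i = \<bar>factor j - 1\<bar> * half j i" if "b i < b j"
      proof -
        have "post j i - half j i = (factor j - 1) * half j i"
          using row_scaled(1)[OF j i that] by (simp add: left_diff_distrib)
        then show ?thesis using half_nonneg[OF j i] by (simp add: Y_def abs_mult)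
      qed
      then show "(if b i < b j then Y j i else 0)
        \<le> \<bar>factor j - 1\<bar> * (if b i < b j then half j i else pre j i)"
        using pre_nonneg[OF j i] by simp
    qed
    also have "\<bar>factor j - 1\<bar> * r j = \<bar>mean j - r j\<bar>"
    proof -
      have "mean j - r j = (factor j - 1) * r j" by (simp add: mean_def left_diff_distrib)
      then show ?thesis using rc_pos(1)[OF j] by (simp add: abs_mult)
    qed
    also have "(\<Sum>i\<in>V. if b i < b j then Y i j else 0) \<le> \<bar>1 / factor j - 1\<bar> * c j"
      unfolding c_eq sum_distrib_left
    proof (intro sum_mono)
      fix i assume i: "i \<in> V"
      have "Y i j = \<bar>1 / factor j - 1\<bar> * half i j" if "b i < b j"
      proof -
        have "post i j - half i j = (1 / factor j - 1) * half i j"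
          using column_scaled(1)[OF j i that] by (simp add: left_diff_distrib)
        then show ?thesis using half_nonneg[OF i j] by (simp add: Y_def abs_mult)
      qed
      then show "(if b i < b j then Y i j else 0)
        \<le> \<bar>1 / factor j - 1\<bar> * (if b i < b j then half i j else pre i j)"
        using pre_nonneg[OF i j] by simp
    qed
    also have "\<bar>1 / factor j - 1\<bar> * c j = \<bar>mean j - c j\<bar>"
    proof -
      have "mean j - c j = (1 / factor j - 1) * c j" by (simp add: mean_eq_c[OF j] left_diff_distrib)
      then show ?thesis using rc_pos(2)[OF j] by (simp add: abs_mult)
    qed
    finally show "(\<Sum>i\<in>V. if b i < b j then Y j i + Y i j else 0) \<le> \<bar>r j - c j\<bar>"
      using abs_mean_diff[OF j] by simp
  qed
  finally show ?thesis .
qed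

text \<open>
  Factor \<open>(r j - c j)^2 = (r j + c j - 2 * mean j) * (r j + c j + 2 * mean j)\<close> and apply Cauchy-Schwarz.
  The first factors add up exactly to the loss of weight in the cycle, the second ones are bounded by a
  multiple of the initial weight through \<open>half_total_le\<close>.
\<close>

theorem imbalance_after_squared_le:
  "(imbalance V a v)\<^sup>2 \<le> 16 / 3 * weight V a u * (weight V a u - weight V a v)"
proof -
  define x where "x j = r j + c j - 2 * mean j" for j
  define y where "y j = r j + c j + 2 * mean j" for j
  have nonneg: "0 \<le> x j" "0 \<le> y j" if "j \<in> V" for j
    using mean_le[OF that] rc_pos[OF that] factor_pos[of j] by (simp_all add: x_def y_def mean_def)
  have abs_eq: "\<bar>r j - c j\<bar> = sqrt (x j) * sqrt (y j)" if "j \<in> V" for j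
  proof -
    have "(r j - c j)\<^sup>2 = x j * y j"
      using mean_squared[OF that] by (simp add: x_def y_def power2_eq_square algebra_simps)
    then show ?thesis by (metis real_sqrt_abs real_sqrt_mult)
  qed
  have "(imbalance V a v)\<^sup>2 \<le> (\<Sum>j\<in>V. sqrt (x j) * sqrt (y j))\<^sup>2"
    using imbalance_after_le abs_eq
    by (intro power_mono) (simp_all add: imbalance_def sum_nonneg)
  also have "\<dots> \<le> (\<Sum>j\<in>V. (sqrt (x j))\<^sup>2) * (\<Sum>j\<in>V. (sqrt (y j))\<^sup>2)"
    by (rule Cauchy_Schwarz_ineq_sum)
  also have "\<dots> = (\<Sum>j\<in>V. x j) * (\<Sum>j\<in>V. y j)"
    using nonneg by simp
  also have "(\<Sum>j\<in>V. x j) = weight V a u - weight V a v"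
    using sum_before sum_after by (simp add: x_def sum_subtractf)
  also have "(weight V a u - weight V a v) * (\<Sum>j\<in>V. y j)
      \<le> (weight V a u - weight V a v) * (16 / 3 * weight V a u)"
  proof (rule mult_left_mono)
    have "(\<Sum>j\<in>V. y j) \<le> (\<Sum>j\<in>V. 2 * (r j + c j))"
    proof (intro sum_mono)
      fix j assume "j \<in> V"
      then show "y j \<le> 2 * (r j + c j)" using nonneg(1)[of j] by (simp add: x_def y_def)
    qed
    also have "\<dots> = 2 * (half_total + weight V a u)"
      by (simp only: sum_before flip: sum_distrib_left)
    finally show "(\<Sum>j\<in>V. y j) \<le> 16 / 3 * weight V a u"
      using half_total_le by simp
    show "0 \<le> weight V a u - weight V a v" using weight_decreases by simp
  qed
  finally show ?thesis by (simp add: mult_ac)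
qed

end

section \<open>Decrease of the logarithmic weight\<close>

lemma one_minus_inverse_le_ln: "0 < x \<Longrightarrow> 1 - 1 / x \<le> ln x" for x :: real
  using ln_le_minus_one[of "1 / x"] by (simp add: ln_div)

lemma imbalance_le_twice_weight:
  assumes "\<And>i j. i \<in> V \<Longrightarrow> j \<in> V \<Longrightarrow> 0 \<le> a i j"
  shows "imbalance V a u \<le> 2 * weight V a u"
proof -
  have "imbalance V a u \<le> (\<Sum>j\<in>V. outflow V a u j + inflow V a u j)"
    unfolding imbalance_def
  proof (intro sum_mono)
    fix j assume "j \<in> V"
    then have "0 \<le> outflow V a u j" "0 \<le> inflow V a u j"
      using assms by (auto simp: outflow_def inflow_def entry_def intro!: sum_nonneg)
    then show "\<bar>outflow V a u j - inflow V a u j\<bar> \<le> outflow V a u j + inflow V a u j" by simp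
  qed
  also have "\<dots> = 2 * weight V a u"
    unfolding sum.distrib outflow_def inflow_def weight_def
    using sum.swap[of "\<lambda>j i. entry a u i j" V V] by simp
  finally show ?thesis .
qed

text \<open>
  The preceding estimate in terms of the relative imbalance \<open>e\<close>.  If the weight at most halves, both
  weights in the estimate are comparable; if it drops further, the logarithm falls by at least 1/2,
  which suffices since \<open>e \<le> 2\<close> always holds.
\<close>

lemma (in osborne_sweep) ln_weight_drop:
  assumes "0 < weight V a v"
  shows "3 / 64 * (imbalance V a v / weight V a v)\<^sup>2 \<le> ln (weight V a u) - ln (weight V a v)"
proof -
  define F where "F = weight V a v"
  define x where "x = weight V a u / F"
  define e where "e = imbalance V a v / F"
  have F: "0 < F" using assms by (simp add: F_def)
  have x: "1 \<le> x" using weight_decreases F by (simp add: x_def F_def)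
  have e: "0 \<le> e" "e \<le> 2"
    using F imbalance_le_twice_weight[of V a v] a_nonneg
    by (auto simp: e_def F_def field_simps imbalance_def intro!: divide_nonneg_nonneg sum_nonneg)
  have "e\<^sup>2 = (imbalance V a v)\<^sup>2 / F\<^sup>2" by (simp add: e_def power_divide)
  also have "\<dots> \<le> 16 / 3 * weight V a u * (weight V a u - F) / F\<^sup>2"
    using imbalance_after_squared_le by (intro divide_right_mono) (simp_all add: F_def)
  also have "\<dots> = 16 / 3 * x * (x - 1)"
    using F by (simp add: x_def field_simps power2_eq_square)
  finally have e2: "e\<^sup>2 \<le> 16 / 3 * x * (x - 1)" .
  have "3 / 64 * e\<^sup>2 \<le> 1 - 1 / x"
  proof (cases "x \<le> 2")
    case True
    have "3 / 64 * e\<^sup>2 * x \<le> 3 / 64 * (16 / 3 * x * (x - 1)) * x"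
      using e2 x by (intro mult_right_mono mult_left_mono) auto
    also have "\<dots> = (x * x) * (x - 1) / 4" by simp
    also have "\<dots> \<le> (2 * 2) * (x - 1) / 4"
      using True x by (intro divide_right_mono mult_right_mono mult_mono) auto
    also have "\<dots> = x - 1" by simp
    finally have "3 / 64 * e\<^sup>2 * x \<le> x - 1" .
    then have "3 / 64 * e\<^sup>2 \<le> (x - 1) / x" using x by (subst pos_le_divide_eq) auto
    also have "(x - 1) / x = 1 - 1 / x" using x by (simp add: diff_divide_distrib)
    finally show ?thesis .
  next
    case False
    have "e\<^sup>2 \<le> 2\<^sup>2" using e by (intro power_mono)
    moreover have "1 / x \<le> 1 / 2" using False by (simp add: field_simps)
    ultimately show ?thesis by simp
  qed
  also have "\<dots> \<le> ln x" using x by (intro one_minus_inverse_le_ln) simp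
  also have "ln x = ln (weight V a u) - ln F"
    unfolding x_def using F weight_decreases by (subst ln_div) (auto simp: F_def)
  finally show ?thesis by (simp add: e_def F_def)
qed

text \<open>
  Convexity of the logarithm of the weight in the potential.  Its gradient at \<open>u\<close> has the coordinates
  \<open>(outflow - inflow) / weight\<close>, which add up to 0, so the potentials need to be close only up to a
  common shift \<open>t\<close>.  The convexity inequality is Jensen's inequality for \<open>exp\<close>, proved by the
  tangent of \<open>exp\<close> at the mean exponent \<open>m\<close>.
\<close>

lemma ln_weight_gap_le:
  assumes nonneg: "\<And>i j. i \<in> V \<Longrightarrow> j \<in> V \<Longrightarrow> 0 \<le> a i j"
    and pos: "0 < weight V a u"
    and near: "\<And>i. i \<in> V \<Longrightarrow> \<bar>v i - u i - t\<bar> \<le> R"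
  shows "ln (weight V a u) - ln (weight V a v) \<le> R * (imbalance V a u / weight V a u)"
proof -
  define w where "w i = v i - u i - t" for i
  define F where "F = weight V a u"
  define m where "m = (\<Sum>i\<in>V. \<Sum>j\<in>V. entry a u i j * (w i - w j)) / F"
  have F: "0 < F" using pos by (simp add: F_def)
  have mF: "m * F = (\<Sum>j\<in>V. (outflow V a u j - inflow V a u j) * w j)"
  proof -
    have "m * F = (\<Sum>i\<in>V. \<Sum>j\<in>V. entry a u i j * w i) - (\<Sum>i\<in>V. \<Sum>j\<in>V. entry a u i j * w j)"
      using F by (simp add: m_def right_diff_distrib sum_subtractf)
    also have "(\<Sum>i\<in>V. \<Sum>j\<in>V. entry a u i j * w j) = (\<Sum>j\<in>V. \<Sum>i\<in>V. entry a u i j * w j)"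
      by (rule sum.swap)
    finally show ?thesis
      by (simp add: outflow_def inflow_def left_diff_distrib sum_subtractf sum_distrib_right)
  qed
  have "- (m * F) \<le> \<bar>m * F\<bar>" by simp
  also have "\<dots> \<le> (\<Sum>j\<in>V. \<bar>(outflow V a u j - inflow V a u j) * w j\<bar>)"
    unfolding mF by (rule sum_abs)
  also have "\<dots> \<le> (\<Sum>j\<in>V. \<bar>outflow V a u j - inflow V a u j\<bar> * R)"
    using near by (intro sum_mono) (auto simp: abs_mult w_def intro!: mult_left_mono)
  also have "\<dots> = R * imbalance V a u"
    by (simp add: imbalance_def sum_distrib_left mult.commute)
  finally have m: "- m \<le> R * (imbalance V a u / F)"
    using F by (simp add: field_simps)
  have "exp m * F = exp m * (\<Sum>i\<in>V. \<Sum>j\<in>V. entry a u i j * (1 + ((w i - w j) - m)))"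
  proof -
    have "(\<Sum>i\<in>V. \<Sum>j\<in>V. entry a u i j * (1 + ((w i - w j) - m)))
      = (\<Sum>i\<in>V. \<Sum>j\<in>V. entry a u i j) + ((\<Sum>i\<in>V. \<Sum>j\<in>V. entry a u i j * (w i - w j))
        - (\<Sum>i\<in>V. \<Sum>j\<in>V. entry a u i j) * m)"
      by (simp only: distrib_left right_diff_distrib[of _ "w _ - w _"] sum.distrib sum_subtractf
          sum_distrib_right mult_1_right)
    also have "\<dots> = F + (m * F - F * m)"
      using F by (simp add: m_def F_def weight_def)
    finally show ?thesis by simp
  qed
  also have "\<dots> \<le> weight V a v"
    unfolding sum_distrib_left weight_def
  proof (intro sum_mono)
    fix i j assume ij: "i \<in> V" "j \<in> V"
    have "exp m * (1 + ((w i - w j) - m)) \<le> exp m * exp ((w i - w j) - m)"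
      by (intro mult_left_mono exp_ge_add_one_self) simp
    also have "\<dots> = exp (w i - w j)" by (simp flip: exp_add)
    finally have "entry a u i j * (exp m * (1 + ((w i - w j) - m))) \<le> entry a u i j * exp (w i - w j)"
      using nonneg[OF ij] by (intro mult_left_mono) (simp_all add: entry_def)
    also have "\<dots> = entry a v i j"
      by (simp add: entry_def w_def flip: exp_add)
    finally show "exp m * (entry a u i j * (1 + ((w i - w j) - m))) \<le> entry a v i j"
      by (simp add: mult.left_commute)
  qed
  finally have lower: "exp m * F \<le> weight V a v" .
  have "m + ln F = ln (exp m * F)" using F by (simp add: ln_mult)
  also have "\<dots> \<le> ln (weight V a v)"
    using lower F by (intro ln_mono) (auto intro: less_le_trans[rotated])
  finally show ?thesis using m by (simp add: F_def)
qed

section \<open>Recurrences for the potential function\<close>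

text \<open>
  The discrete analogue of \<open>\<delta>' = - a \<delta>^2\<close>, whose solutions decay like \<open>1 / (a k)\<close>.
\<close>

lemma small_gap_of_square_decrease:
  fixes \<delta> :: "nat \<Rightarrow> real"
  assumes a: "0 < a" and start: "\<delta> 0 \<le> 2 / a"
    and step: "\<And>k. k < h \<Longrightarrow> a * (\<delta> (Suc k))\<^sup>2 \<le> \<delta> k - \<delta> (Suc k)"
  shows "k \<le> h \<Longrightarrow> \<delta> k \<le> 2 / (a * (real k + 1))"
proof (induction k)
  case 0
  then show ?case using start by simp
next
  case (Suc k)
  show ?case
  proof (rule ccontr)
    define q where "q = 2 / (a * (real k + 2))"
    assume "\<not> ?case"
    then have q: "q < \<delta> (Suc k)" by (simp add: q_def add.commute)
    have "0 < q" using a by (simp add: q_def)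
    have "q + a * q\<^sup>2 < \<delta> (Suc k) + a * (\<delta> (Suc k))\<^sup>2"
      using q \<open>0 < q\<close> a by (intro add_less_le_mono mult_left_mono power_mono) auto
    also have "\<dots> \<le> \<delta> k" using step[of k] Suc.prems by simp
    also have "\<dots> \<le> 2 / (a * (real k + 1))" using Suc by simp
    also have "\<dots> \<le> q + a * q\<^sup>2"
    proof -
      have "1 / (real k + 1) \<le> 1 / (real k + 2) * (1 + 2 / (real k + 2))"
        by (simp add: divide_simps) (simp add: algebra_simps)
      then have "2 / a * (1 / (real k + 1)) \<le> 2 / a * (1 / (real k + 2) * (1 + 2 / (real k + 2)))"
        using a by (intro mult_left_mono) auto
      also have "\<dots> = q * (1 + a * q)" using a by (simp add: q_def)
      also have "\<dots> = q + a * q\<^sup>2" by (simp add: algebra_simps power2_eq_square)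
      finally show ?thesis by simp
    qed
    finally show False by simp
  qed
qed

lemma linear_decrease:
  fixes \<Phi> :: "nat \<Rightarrow> real"
  assumes "\<And>k. h \<le> k \<Longrightarrow> k < N \<Longrightarrow> q \<le> \<Phi> k - \<Phi> (Suc k)" and "h \<le> N"
  shows "real (N - h) * q \<le> \<Phi> h - \<Phi> N"
  using assms(2,1)
proof (induction N rule: dec_induct)
  case (step N)
  have "real (Suc N - h) * q = real (N - h) * q + q"
    using step.hyps by (simp add: Suc_diff_le algebra_simps)
  also have "\<dots> \<le> (\<Phi> h - \<Phi> N) + (\<Phi> N - \<Phi> (Suc N))"
    using step by (intro add_mono) auto
  finally show ?case by simp
qed simp

text \<open>
  While the error \<open>e\<close> exceeds \<open>\<epsilon>\<close>, each step consumes \<open>c \<epsilon>^2\<close> of a budget of \<open>L\<close>.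
\<close>

lemma early_small_error:
  fixes \<Phi> e :: "nat \<Rightarrow> real"
  assumes "0 < c" "0 < \<epsilon>" "0 \<le> L"
    and drop: "\<And>k. c * (e (Suc k))\<^sup>2 \<le> \<Phi> k - \<Phi> (Suc k)"
    and total: "\<And>k. \<Phi> 0 - \<Phi> k \<le> L"
  shows "\<exists>k. real k \<le> L / (c * \<epsilon>\<^sup>2) + 1 \<and> e k \<le> \<epsilon>"
proof (rule ccontr)
  assume none: "\<not> ?thesis"
  define N where "N = nat \<lfloor>L / (c * \<epsilon>\<^sup>2) + 1\<rfloor>"
  have pos: "0 < c * \<epsilon>\<^sup>2" using assms by simp
  then have "0 \<le> L / (c * \<epsilon>\<^sup>2)" using assms by simp
  then have N: "L / (c * \<epsilon>\<^sup>2) < real N" "real N \<le> L / (c * \<epsilon>\<^sup>2) + 1"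
    unfolding N_def by linarith+
  have "real (N - 0) * (c * \<epsilon>\<^sup>2) \<le> \<Phi> 0 - \<Phi> N"
  proof (rule linear_decrease)
    fix k assume "k < N"
    then have "\<epsilon> \<le> e (Suc k)" using none N(2) by (smt (verit) Suc_leI of_nat_mono)
    then have "c * \<epsilon>\<^sup>2 \<le> c * (e (Suc k))\<^sup>2"
      using assms(1,2) by (intro mult_left_mono power_mono) auto
    then show "c * \<epsilon>\<^sup>2 \<le> \<Phi> k - \<Phi> (Suc k)" using drop[of k] by simp
  qed simp
  then have "real N * (c * \<epsilon>\<^sup>2) \<le> L" using total[of N] by simp
  then show False using N(1) pos by (simp add: divide_less_eq)
qed

text \<open>
  If moreover the gap of \<open>\<Phi>\<close> is at most \<open>R * e\<close>, the drop \<open>c e^2\<close> is at least \<open>(c / R^2)\<close> times the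
  squared gap, so after \<open>h\<close> steps the gap to a later value is \<open>O(R^2 / (c h))\<close>.  As long as the error
  exceeds \<open>\<epsilon>\<close>, the next \<open>h\<close> steps consume \<open>h c \<epsilon>^2\<close> of that remaining gap, so
  \<open>h = O(R / (c \<epsilon>))\<close>.  Splitting the run in this way avoids the logarithmic factor that repeated halving
  of the gap at rate \<open>c \<epsilon> / R\<close> would cost.  The reference point is the last value
  considered instead of the infimum, so no minimiser has to exist.
\<close>

lemma early_small_error_of_gap_bound:
  fixes \<Phi> e :: "nat \<Rightarrow> real"
  assumes "0 < c" "0 < \<epsilon>" "c \<le> 2 * R"
    and drop: "\<And>k. c * (e (Suc k))\<^sup>2 \<le> \<Phi> k - \<Phi> (Suc k)"
    and total: "\<And>k. \<Phi> 0 - \<Phi> k \<le> R"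
    and gap: "\<And>k N. \<Phi> k - \<Phi> N \<le> R * e k"
  shows "\<exists>k. real k \<le> 4 * R / (c * \<epsilon>) + 2 \<and> e k \<le> \<epsilon>"
proof (rule ccontr)
  assume none: "\<not> ?thesis"
  have R: "0 < R" using assms by linarith
  define h where "h = nat \<lfloor>2 * R / (c * \<epsilon>) + 1\<rfloor>"
  have "0 \<le> 2 * R / (c * \<epsilon>)" using assms R by simp
  then have h: "2 * R / (c * \<epsilon>) < real h" "real h \<le> 2 * R / (c * \<epsilon>) + 1"
    unfolding h_def by linarith+
  have h2: "real (2 * h) \<le> 4 * R / (c * \<epsilon>) + 2" using h(2) by simp
  have large: "\<epsilon> < e k" if "k \<le> 2 * h" for k
  proof -
    have "real k \<le> 4 * R / (c * \<epsilon>) + 2" using that h2 by linarith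
    then show ?thesis using none by force
  qed
  have mono: "\<Phi> (Suc k) \<le> \<Phi> k" for k
    using drop[of k] assms(1) zero_le_mult_iff[of c "(e (Suc k))\<^sup>2"] by (smt (verit) zero_le_power2)
  define \<delta> where "\<delta> k = \<Phi> k - \<Phi> (2 * h)" for k
  \<comment> \<open>the first half of the run makes the remaining gap small\<close>
  have "\<delta> h \<le> 2 / (c / R\<^sup>2 * (real h + 1))"
  proof (rule small_gap_of_square_decrease[of _ \<delta> h])
    show "0 < c / R\<^sup>2" using assms R by simp
    have "\<delta> 0 \<le> R" using total[of "2 * h"] by (simp add: \<delta>_def)
    also have "R \<le> 2 / (c / R\<^sup>2)"
      using assms R by (simp add: field_simps power2_eq_square)
    finally show "\<delta> 0 \<le> 2 / (c / R\<^sup>2)" .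
    show "c / R\<^sup>2 * (\<delta> (Suc k))\<^sup>2 \<le> \<delta> k - \<delta> (Suc k)" if "k < h" for k
    proof -
      have "0 \<le> \<delta> (Suc k)"
        using lift_Suc_antimono_le[of \<Phi> "Suc k" "2 * h"] mono that by (simp add: \<delta>_def)
      then have "(\<delta> (Suc k))\<^sup>2 \<le> (R * e (Suc k))\<^sup>2"
        using gap[of "Suc k" "2 * h"] by (intro power_mono) (simp_all add: \<delta>_def)
      then have "c / R\<^sup>2 * (\<delta> (Suc k))\<^sup>2 \<le> c / R\<^sup>2 * (R * e (Suc k))\<^sup>2"
        using assms by (intro mult_left_mono) auto
      also have "\<dots> = c * (e (Suc k))\<^sup>2" using R by (simp add: power_mult_distrib)
      finally show ?thesis using drop[of k] by (simp add: \<delta>_def)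
    qed
  qed simp
  \<comment> \<open>the second half cannot lose more than that gap\<close>
  moreover have "real (2 * h - h) * (c * \<epsilon>\<^sup>2) \<le> \<Phi> h - \<Phi> (2 * h)"
  proof (rule linear_decrease)
    fix k assume "k < 2 * h"
    then have "\<epsilon> \<le> e (Suc k)" using large[of "Suc k"] by simp
    then have "c * \<epsilon>\<^sup>2 \<le> c * (e (Suc k))\<^sup>2"
      using assms(1,2) by (intro mult_left_mono power_mono) auto
    then show "c * \<epsilon>\<^sup>2 \<le> \<Phi> k - \<Phi> (Suc k)" using drop[of k] by simp
  qed simp
  ultimately have "real h * (c * \<epsilon>\<^sup>2) \<le> 2 / (c / R\<^sup>2 * (real h + 1))"
    by (simp add: \<delta>_def)
  also have "\<dots> = 2 * R\<^sup>2 / (c * (real h + 1))" by simp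
  finally have "real h * (c * \<epsilon>\<^sup>2) * (c * (real h + 1)) \<le> 2 * R\<^sup>2"
    using assms(1) by (subst (asm) pos_le_divide_eq) auto
  then have "real h * (real h + 1) * (c * \<epsilon>)\<^sup>2 \<le> 2 * R\<^sup>2"
    by (simp add: power2_eq_square mult_ac)
  moreover have four: "(2 * R)\<^sup>2 = 4 * R\<^sup>2" by (simp add: power_mult_distrib)
  moreover have "(2 * R)\<^sup>2 < (real h * (c * \<epsilon>))\<^sup>2"
    using h(1) assms(1,2) R by (intro power_strict_mono) (simp_all add: divide_less_eq)
  moreover have "(real h * (c * \<epsilon>))\<^sup>2 \<le> real h * (real h + 1) * (c * \<epsilon>)\<^sup>2"
    unfolding power_mult_distrib by (rule mult_right_mono) (simp_all add: power2_eq_square[of "real h"] distrib_left)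
  ultimately show False
    using zero_less_power[OF R, of 2] four by linarith
qed

section \<open>Scaled matrices as weighted digraphs\<close>

abbreviation (input) entries :: "real mat \<Rightarrow> nat \<Rightarrow> nat \<Rightarrow> real" where
  "entries A i j \<equiv> A $$ (i, j)"

lemma scaled_index:
  assumes "A \<in> carrier_mat n n" "i < n" "j < n"
  shows "scaled A u $$ (i, j) = entry (entries A) (($) u) i j"
proof -
  have "scaled A u = Matrix.mat n n (\<lambda>(i, j). exp (u $ i) * A $$ (i, j)) * mat_diag n (\<lambda>i. exp (- u $ i))"
    using assms by (simp add: scaled_def mat_diag_mult_left[of _ n n])
  also have "\<dots> = Matrix.mat n n (\<lambda>(i, j). exp (u $ i) * A $$ (i, j) * exp (- u $ j))"
    by (subst mat_diag_mult_right[of _ n n]) (auto intro!: eq_matI)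
  finally show ?thesis
    using assms by (simp add: entry_def exp_diff exp_minus field_simps)
qed

lemma row_sum_eq:
  assumes "A \<in> carrier_mat n n" "j < n"
  shows "row_sum A u j = outflow {..<n} (entries A) (($) u) j"
  using assms by (auto simp: row_sum_def outflow_def scaled_index intro!: sum.cong)

lemma col_sum_eq:
  assumes "A \<in> carrier_mat n n" "j < n"
  shows "col_sum A u j = inflow {..<n} (entries A) (($) u) j"
  using assms by (auto simp: col_sum_def inflow_def scaled_index intro!: sum.cong)

lemma sum_mat_scaled:
  assumes "A \<in> carrier_mat n n"
  shows "sum_mat (scaled A u) = weight {..<n} (entries A) (($) u)"
proof -
  have "dim_row (scaled A u) = n" "dim_col (scaled A u) = n"
    using assms by (auto simp: scaled_def mat_diag_def)
  then have "sum_mat (scaled A u) = (\<Sum>(i, j)\<in>{0..<n} \<times> {0..<n}. scaled A u $$ (i, j))"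
    by (simp add: sum_mat_def)
  also have "\<dots> = (\<Sum>(i, j)\<in>{..<n} \<times> {..<n}. entry (entries A) (($) u) i j)"
    using assms by (intro sum.cong) (auto simp: scaled_index)
  finally show ?thesis by (simp add: weight_def sum.cartesian_product)
qed

lemma eps_balances_iff:
  assumes "A \<in> carrier_mat n n"
  shows "eps_balances \<epsilon> u A \<longleftrightarrow>
    imbalance {..<n} (entries A) (($) u) \<le> \<epsilon> * weight {..<n} (entries A) (($) u)"
  using assms by (simp add: eps_balances_def sum_mat_scaled imbalance_def row_sum_eq col_sum_eq)

section \<open>Strong connectivity and the range of the potential\<close>

locale balanceable_matrix =
  fixes n :: nat and A :: "real mat"
  assumes n: "2 \<le> n" and A: "A \<in> carrier_mat n n"
    and nonneg: "\<And>i j. i < n \<Longrightarrow> j < n \<Longrightarrow> 0 \<le> A $$ (i, j)"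
    and balanceable: "balanceable A"
begin

abbreviation "G \<equiv> with_proj (mat_graph A)"
abbreviation "V \<equiv> {..<n}"
abbreviation "a \<equiv> entries A"

definition d :: nat where "d = graph_diameter G"
definition a_min :: real where "a_min = Min {A $$ (i, j) | i j. (i, j) \<in> nonzero_entries A}"
definition L :: real where "L = ln (kappa A)"

lemma dims [simp]: "dim_row A = n" "dim_col A = n" using A by auto

lemma arcs_iff: "e \<in> nonzero_entries A \<longleftrightarrow> fst e < n \<and> snd e < n \<and> A $$ e \<noteq> 0"
  by (auto simp: nonzero_entries_def)

lemma finite_nonzero: "finite (nonzero_entries A)"
  by (rule finite_subset[of _ "V \<times> V"]) (auto simp: nonzero_entries_def)

lemma verts_G: "verts G = {0..<n}" and parcs_G: "parcs (mat_graph A) = nonzero_entries A"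
  by (auto simp: mat_graph_def)

sublocale wf_digraph G
  by unfold_locales (auto simp: mat_graph_def arcs_iff)

lemma reach: "i < n \<Longrightarrow> j < n \<Longrightarrow> i \<rightarrow>\<^sup>*\<^bsub>G\<^esub> j"
  using balanceable verts_G by (auto simp: balanceable_def strongly_connected_def)

lemma reach1:
  assumes "i < n" "j < n" "i \<noteq> j"
  shows "(i, j) \<in> (nonzero_entries A)\<^sup>+"
  using reachable_neq_reachable1[OF reach[OF assms(1,2)] assms(3)] by (simp add: parcs_G)

lemma other_vertex: "\<exists>k<n. k \<noteq> (i::nat)"
  using n by (cases "i = 0") (auto intro: exI[of _ 1] exI[of _ 0])

lemma out_arc: assumes "i < n" shows "\<exists>j<n. A $$ (i, j) \<noteq> 0"
proof -
  obtain k where "k < n" "i \<noteq> k" using other_vertex by metis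
  from reach1[OF assms this] show ?thesis
    by (cases rule: converse_tranclE) (auto simp: arcs_iff)
qed

lemma in_arc: assumes "i < n" shows "\<exists>j<n. A $$ (j, i) \<noteq> 0"
proof -
  obtain k where "k < n" "k \<noteq> i" using other_vertex by metis
  from reach1[OF this(1) assms this(2)] show ?thesis
    by (cases rule: tranclE) (auto simp: arcs_iff)
qed

lemma flow_pos:
  assumes "j < n"
  shows "0 < outflow V a u j" "0 < inflow V a u j"
proof -
  obtain i i' where i: "i < n" "A $$ (j, i) \<noteq> 0" "i' < n" "A $$ (i', j) \<noteq> 0"
    using out_arc in_arc assms by metis
  have "0 < A $$ (j, i)" "0 < A $$ (i', j)"
    using nonneg[OF assms i(1)] nonneg[OF i(3) assms] i by auto
  then have "0 < entry a u j i" "0 < entry a u i' j" by (auto simp: entry_def)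
  then show "0 < outflow V a u j" "0 < inflow V a u j"
    unfolding outflow_def inflow_def
    using i assms nonneg sum_pos2[of V i "entry a u j"] sum_pos2[of V i' "\<lambda>i. entry a u i j"]
    by (auto simp: entry_def)
qed

lemma weight_eq_sum_outflow: "weight V a u = (\<Sum>i\<in>V. outflow V a u i)"
  by (simp add: weight_def outflow_def)

lemma V_nonempty: "V \<noteq> {}"
  using n by (metis lessThan_empty_iff not_numeral_le_zero)

lemma weight_pos: "0 < weight V a u"
  unfolding weight_eq_sum_outflow using flow_pos V_nonempty by (intro sum_pos) auto

lemma entry_le_weight: assumes "i < n" "j < n" shows "entry a u i j \<le> weight V a u"
proof -
  have "entry a u i j \<le> outflow V a u i"
    unfolding outflow_def using assms nonneg by (intro member_le_sum) (auto simp: entry_def)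
  also have "\<dots> \<le> weight V a u"
    unfolding weight_eq_sum_outflow using assms flow_pos
    by (intro member_le_sum) (auto simp: less_imp_le)
  finally show ?thesis .
qed

lemma values_eq: "{A $$ (i, j) | i j. (i, j) \<in> nonzero_entries A} = ($$) A ` nonzero_entries A"
  by auto

lemma a_min_le: assumes "i < n" "j < n" "A $$ (i, j) \<noteq> 0" shows "a_min \<le> A $$ (i, j)"
  unfolding a_min_def values_eq using assms finite_nonzero
  by (intro Min_le) (auto simp: arcs_iff)

lemma a_min_pos: "0 < a_min"
proof -
  obtain j where "j < n" "A $$ (0, j) \<noteq> 0" using out_arc[of 0] n by auto
  then have "(0, j) \<in> nonzero_entries A" using n by (simp add: arcs_iff)
  then have "nonzero_entries A \<noteq> {}" by auto
  then have "a_min \<in> ($$) A ` nonzero_entries A"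
    unfolding a_min_def values_eq using finite_nonzero by (intro Min_in) auto
  then show ?thesis using nonneg by (force simp: arcs_iff)
qed

lemma kappa_eq: "kappa A = weight V a (\<lambda>_. 0) / a_min"
proof -
  have "sum_mat A = (\<Sum>(i, j)\<in>V \<times> V. a i j)"
    by (simp add: sum_mat_def lessThan_atLeast0 case_prod_unfold)
  then show ?thesis
    by (simp add: kappa_def a_min_def weight_def entry_def sum.cartesian_product)
qed

lemma kappa_ge_2: "2 \<le> kappa A"
proof -
  have "a_min \<le> outflow V a (\<lambda>_. 0) i" if i: "i < n" for i
  proof -
    obtain j where j: "j < n" "A $$ (i, j) \<noteq> 0" using out_arc i by metis
    then have "a_min \<le> entry a (\<lambda>_. 0) i j" using a_min_le[OF i j] by (simp add: entry_def)
    also have "\<dots> \<le> outflow V a (\<lambda>_. 0) i"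
      unfolding outflow_def using i j nonneg by (intro member_le_sum) (auto simp: entry_def)
    finally show ?thesis .
  qed
  then have "(\<Sum>i\<in>V. a_min) \<le> weight V a (\<lambda>_. 0)"
    unfolding weight_eq_sum_outflow by (intro sum_mono) simp
  moreover have "2 * a_min \<le> real n * a_min" using n a_min_pos by (intro mult_right_mono) auto
  ultimately have "2 * a_min \<le> weight V a (\<lambda>_. 0)" by simp
  then show ?thesis using a_min_pos by (simp add: kappa_eq le_divide_eq)
qed

lemma L_ge: "1 / 2 \<le> L"
proof -
  have "1 / 2 \<le> 1 - 1 / kappa A" using kappa_ge_2 by (simp add: field_simps)
  also have "\<dots> \<le> L"
    unfolding L_def using kappa_ge_2 by (intro one_minus_inverse_le_ln) simp
  finally show ?thesis .
qed

text \<open>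
  No scaling brings the weight below the smallest entry: an arc out of a vertex of maximal potential is
  not scaled down.
\<close>

lemma a_min_le_weight: "a_min \<le> weight V a u"
proof -
  obtain i where i: "i \<in> V" "\<And>k. k \<in> V \<Longrightarrow> u k \<le> u i"
  proof -
    have "Max (u ` V) \<in> u ` V" using V_nonempty by (intro Max_in) auto
    then obtain i where "i \<in> V" "u i = Max (u ` V)" by auto
    then show thesis using that[of i] by simp
  qed
  obtain j where j: "j < n" "A $$ (i, j) \<noteq> 0" using out_arc i by auto
  have "a_min \<le> A $$ (i, j) * 1" using a_min_le i j by simp
  also have "\<dots> \<le> entry a u i j"
    unfolding entry_def using i j nonneg by (intro mult_left_mono) auto
  also have "\<dots> \<le> weight V a u" using entry_le_weight i j by simp
  finally show ?thesis .
qed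

lemma ln_weight_range: "ln (weight V a (\<lambda>_. 0)) - ln (weight V a u) \<le> L"
proof -
  have "L = ln (weight V a (\<lambda>_. 0)) - ln a_min"
    unfolding L_def kappa_eq using weight_pos[of "\<lambda>_. 0"] a_min_pos by (simp add: ln_div)
  moreover have "ln a_min \<le> ln (weight V a u)" using a_min_le_weight a_min_pos by (intro ln_mono)
  ultimately show ?thesis by simp
qed

lemma short_walk:
  assumes "i < n" "j < n"
  shows "\<exists>p. awalk i p j \<and> length p = graph_dist G i j" "graph_dist G i j \<le> d"
proof -
  have "\<exists>k p. apath i p j \<and> length p = k"
    using reach[OF assms] by (auto simp: reachable_apath)
  then have "\<exists>p. apath i p j \<and> length p = graph_dist G i j"
    unfolding graph_dist_def by (rule LeastI_ex)
  then show "\<exists>p. awalk i p j \<and> length p = graph_dist G i j" by (auto simp: apath_def)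
  have "{graph_dist G u v | u v. u \<in> verts G \<and> v \<in> verts G}
      = (\<lambda>(u, v). graph_dist G u v) ` (verts G \<times> verts G)" by auto
  then have "finite {graph_dist G u v | u v. u \<in> verts G \<and> v \<in> verts G}"
    by (simp add: verts_G mat_graph_def)
  then show "graph_dist G i j \<le> d"
    unfolding d_def graph_diameter_def using assms verts_G by (intro Max_ge) auto
qed

lemma d_ge_1: "1 \<le> d"
proof -
  obtain p where p: "awalk 0 p 1" "length p = graph_dist G 0 1" using short_walk(1)[of 0 1] n by auto
  then have "p \<noteq> []" by (auto simp: awalk_Nil_iff)
  then have "1 \<le> length p" by (cases p) auto
  then show ?thesis using p short_walk(2)[of 0 1] n by simp
qed

lemma spread_along_walk:
  assumes step: "\<And>i j. i < n \<Longrightarrow> j < n \<Longrightarrow> A $$ (i, j) \<noteq> 0 \<Longrightarrow> u i - u j \<le> (q::real)"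
  shows "awalk i p j \<Longrightarrow> u i - u j \<le> real (length p) * q"
proof (induction p arbitrary: i)
  case Nil
  then show ?case by (simp add: awalk_Nil_iff)
next
  case (Cons e p)
  then have e: "e \<in> nonzero_entries A" "i = fst e" "awalk (snd e) p j"
    by (auto simp: awalk_Cons_iff parcs_G)
  have "u i - u (snd e) \<le> q" using step[of "fst e" "snd e"] e by (auto simp: arcs_iff)
  with Cons.IH[OF e(3)] show ?case by (simp add: algebra_simps)
qed

text \<open>
  If the weight has not grown, no scaled entry exceeds the initial weight, so the potential falls by at
  most \<open>ln (kappa A)\<close> along an arc.  Shortest walks have at most \<open>d\<close> arcs.
\<close>

lemma sublevel_spread:
  assumes low: "weight V a u \<le> weight V a (\<lambda>_. 0)" and "i < n" "j < n"
  shows "u i - u j \<le> real d * L"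
proof -
  have "u i - u j \<le> L" if ij: "i < n" "j < n" "A $$ (i, j) \<noteq> 0" for i j
  proof -
    have "a_min * exp (u i - u j) \<le> entry a u i j"
      unfolding entry_def using a_min_le[OF ij] by (intro mult_right_mono) auto
    also have "\<dots> \<le> weight V a (\<lambda>_. 0)" using entry_le_weight[OF ij(1,2)] low by (rule order_trans)
    finally have "exp (u i - u j) \<le> kappa A"
      using a_min_pos by (simp add: kappa_eq pos_le_divide_eq mult.commute)
    then have "ln (exp (u i - u j)) \<le> L" unfolding L_def by (intro ln_mono) auto
    then show ?thesis by simp
  qed
  moreover obtain p where p: "awalk i p j" "length p = graph_dist G i j"
    using short_walk assms by metis
  ultimately have "u i - u j \<le> real (length p) * L" by (intro spread_along_walk) auto
  also have "\<dots> \<le> real d * L"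
    using short_walk(2)[OF assms(2,3)] p L_ge by (intro mult_right_mono) auto
  finally show ?thesis .
qed

end

section \<open>Number of cycles\<close>

locale colored_matrix = balanceable_matrix +
  fixes Ss :: "nat set list"
  assumes coloring: "is_coloring Ss A"
begin

lemma blocks_cover: "\<Union> (set Ss) = {..<n}"
  using coloring by (auto simp: is_coloring_def partition_on_def)

lemma block_unique:
  assumes "j \<in> Ss ! k" "j \<in> Ss ! l" "k < length Ss" "l < length Ss"
  shows "k = l"
proof -
  have "disjoint (set Ss)" "distinct Ss"
    using coloring by (auto simp: is_coloring_def partition_on_def)
  then have "Ss ! k = Ss ! l" using assms by (meson disjointD disjoint_iff nth_mem)
  then show ?thesis using \<open>distinct Ss\<close> assms by (simp add: nth_eq_iff_index_eq)
qed

definition color :: "nat \<Rightarrow> nat" where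
  "color j = (SOME k. k < length Ss \<and> j \<in> Ss ! k)"

lemma color: assumes "j < n" shows "color j < length Ss" "j \<in> Ss ! color j"
proof -
  have "\<exists>k. k < length Ss \<and> j \<in> Ss ! k"
    using blocks_cover assms by (metis UnionE in_set_conv_nth lessThan_iff)
  then have "color j < length Ss \<and> j \<in> Ss ! color j" unfolding color_def by (rule someI_ex)
  then show "color j < length Ss" "j \<in> Ss ! color j" by auto
qed

lemma color_iff: "j < n \<Longrightarrow> k < length Ss \<Longrightarrow> j \<in> Ss ! k \<longleftrightarrow> color j = k"
  using color block_unique by blast

definition after_blocks :: "real vec \<Rightarrow> nat \<Rightarrow> real vec" where
  "after_blocks x k = fold (block_update A) (take k Ss) x"

lemma after_blocks_Suc:
  "k < length Ss \<Longrightarrow> after_blocks x (Suc k) = block_update A (Ss ! k) (after_blocks x k)"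
  by (simp add: after_blocks_def take_Suc_conv_app_nth)

lemma after_blocks_all: "after_blocks x (length Ss) = osborne_cycle A Ss x"
  by (simp add: after_blocks_def osborne_cycle_def)

text \<open>
  A coordinate changes only in the block that contains it.
\<close>

lemma after_blocks_index_aux:
  assumes "j < n"
  shows "k \<le> length Ss \<Longrightarrow>
    after_blocks x k $ j = (if color j < k then after_blocks x (Suc (color j)) $ j else x $ j)"
proof (induction k)
  case 0
  then show ?case by (simp add: after_blocks_def)
next
  case (Suc k)
  show ?case
  proof (cases "color j = k")
    case False
    then have "j \<notin> Ss ! k" using color_iff assms Suc.prems by simp
    then have "after_blocks x (Suc k) $ j = after_blocks x k $ j"
      using assms Suc.prems by (simp add: after_blocks_Suc block_update_def)
    then show ?thesis using Suc False by auto
  qed simp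
qed

lemma after_blocks_index:
  assumes "j < n" "k \<le> length Ss"
  shows "after_blocks x k $ j = (if color j < k then osborne_cycle A Ss x $ j else x $ j)"
  using after_blocks_index_aux[OF assms] after_blocks_index_aux[OF assms(1), of "length Ss" x]
    color(1)[OF assms(1)]
  by (simp add: after_blocks_all)

lemma sweep: "osborne_sweep V a color (($) x) (($) (osborne_cycle A Ss x))"
proof
  let ?z = "stage color (($) x) (($) (osborne_cycle A Ss x))"
  show "0 \<le> a i j" if "i \<in> V" "j \<in> V" for i j using nonneg that by simp
  show "a i j = 0" if "i \<in> V" "j \<in> V" "color i = color j" for i j
  proof -
    have "Ss ! color i \<in> set Ss" "i \<in> Ss ! color i" "j \<in> Ss ! color i"
      using color[of i] color[of j] that by auto
    then show ?thesis using coloring unfolding is_coloring_def by blast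
  qed
  show "0 < outflow V a (?z j) j" "0 < inflow V a (?z j) j" if "j \<in> V" for j
    using flow_pos that by auto
  show "osborne_cycle A Ss x $ j = x $ j + ln (inflow V a (?z j) j) / 2 - ln (outflow V a (?z j) j) / 2"
    if "j \<in> V" for j
  proof -
    have j: "j < n" "color j < length Ss" using that color by auto
    let ?w = "after_blocks x (color j)"
    have w: "?w $ i = ?z j i" if "i < n" for i
      using after_blocks_index[OF that, of "color j" x] j by (simp add: stage_def)
    have "osborne_cycle A Ss x $ j = after_blocks x (Suc (color j)) $ j"
      using after_blocks_index[of j "Suc (color j)" x] j by simp
    also have "\<dots> = ?w $ j + ln (col_sum A ?w j) / 2 - ln (row_sum A ?w j) / 2"
      using j color by (simp add: after_blocks_Suc block_update_def)
    also have "?w $ j = x $ j" using after_blocks_index[of j "color j" x] j by simp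
    also have "col_sum A ?w j = inflow V a (?z j) j"
      unfolding col_sum_eq[OF A j(1)] using w j by (intro inflow_cong) auto
    also have "row_sum A ?w j = outflow V a (?z j) j"
      unfolding row_sum_eq[OF A j(1)] using w j by (intro outflow_cong) auto
    finally show ?thesis .
  qed
qed

abbreviation u :: "nat \<Rightarrow> nat \<Rightarrow> real" where "u t i \<equiv> osborne A Ss t $ i"

definition \<Phi> :: "nat \<Rightarrow> real" where "\<Phi> t = ln (weight V a (u t))"
definition err :: "nat \<Rightarrow> real" where "err t = imbalance V a (u t) / weight V a (u t)"

lemma osborne_Suc: "osborne A Ss (Suc t) = osborne_cycle A Ss (osborne A Ss t)"
  by (simp add: osborne_def)

lemma sweep_t: "osborne_sweep V a color (u t) (u (Suc t))"
  using sweep unfolding osborne_Suc .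

lemma weight_start: "weight V a (u 0) = weight V a (\<lambda>_. 0)"
  unfolding weight_def entry_def by (intro sum.cong) (auto simp: osborne_def)

lemma drop: "3 / 64 * (err (Suc t))\<^sup>2 \<le> \<Phi> t - \<Phi> (Suc t)"
  using osborne_sweep.ln_weight_drop[OF sweep_t weight_pos] by (simp add: err_def \<Phi>_def)

lemma weight_le_start: "weight V a (u t) \<le> weight V a (\<lambda>_. 0)"
proof (induction t)
  case (Suc t)
  then show ?case using osborne_sweep.weight_decreases[OF sweep_t[of t]] by simp
qed (simp add: weight_start)

lemma total: "\<Phi> 0 - \<Phi> t \<le> L"
  using ln_weight_range by (simp add: \<Phi>_def weight_start)

text \<open>
  Both potentials lie in the initial sublevel set, hence each varies by at most \<open>d * L\<close> over the
  vertices.  Their difference is shifted so that it vanishes at vertex 0.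
\<close>

lemma gap: "\<Phi> k - \<Phi> N \<le> 2 * real d * L * err k"
  unfolding \<Phi>_def err_def
proof (rule ln_weight_gap_le[where t = "u N 0 - u k 0"])
  fix i assume "i \<in> V"
  then show "\<bar>u N i - u k i - (u N 0 - u k 0)\<bar> \<le> 2 * real d * L"
    using sublevel_spread[OF weight_le_start, of i 0 N] sublevel_spread[OF weight_le_start, of 0 i N]
      sublevel_spread[OF weight_le_start, of i 0 k] sublevel_spread[OF weight_le_start, of 0 i k] n
    by (simp add: abs_le_iff)
qed (use nonneg weight_pos in auto)

lemma balanced_iff: "eps_balances \<epsilon> (osborne A Ss t) A \<longleftrightarrow> err t \<le> \<epsilon>"
  unfolding eps_balances_iff[OF A] err_def using weight_pos by (simp add: divide_le_eq)

text \<open>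
  The two recurrence lemmas give the two branches of the minimum.  The rounding terms \<open>+ 1\<close> and \<open>+ 2\<close>
  in them are absorbed because \<open>ln (kappa A) \<ge> 1 / 2\<close>, \<open>d \<ge> 1\<close> and \<open>\<epsilon> < 2\<close>; for \<open>\<epsilon> \<ge> 2\<close> every scaling is
  \<open>\<epsilon>\<close>-balanced, and no cycle is needed.
\<close>

theorem few_cycles:
  assumes "0 < \<epsilon>"
  shows "\<exists>K. real K \<le> 200 * (L / \<epsilon> * min (1 / \<epsilon>) (real d)) \<and> eps_balances \<epsilon> (osborne A Ss K) A"
proof (cases "2 \<le> \<epsilon>")
  case True
  have "imbalance V a (u 0) \<le> 2 * weight V a (u 0)"
    using nonneg by (intro imbalance_le_twice_weight) auto
  then have "err 0 \<le> 2" using weight_pos by (simp add: err_def divide_le_eq)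
  then show ?thesis using True L_ge by (intro exI[of _ 0]) (auto simp: balanced_iff)
next
  case False
  have half: "1 / \<epsilon> \<ge> 1 / 2" using False assms by (simp add: field_simps)
  show ?thesis
  proof (cases "1 / \<epsilon> \<le> real d")
    case True
    obtain K where K: "real K \<le> L / (3 / 64 * \<epsilon>\<^sup>2) + 1" "err K \<le> \<epsilon>"
      using early_small_error[of "3 / 64" \<epsilon> L err \<Phi>] drop total assms L_ge by auto
    have "1 / 8 \<le> L * (1 / \<epsilon>) * (1 / \<epsilon>)"
      using mult_mono[OF mult_mono[OF L_ge half] half] L_ge assms by simp
    moreover have "L / (3 / 64 * \<epsilon>\<^sup>2) = 64 / 3 * (L * (1 / \<epsilon>) * (1 / \<epsilon>))"
      by (simp add: power2_eq_square)
    ultimately have "real K \<le> 200 * (L * (1 / \<epsilon>) * (1 / \<epsilon>))" using K by linarith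
    then show ?thesis using K True by (auto simp: balanced_iff min_def)
  next
    case False
    have d: "1 \<le> real d" using d_ge_1 by simp
    define R where "R = 2 * real d * L"
    have "L \<le> real d * L" using d L_ge by simp
    then have "L \<le> R" using L_ge by (simp add: R_def)
    then have "\<Phi> 0 - \<Phi> t \<le> R" "3 / 64 \<le> 2 * R" for t
      using total[of t] L_ge by linarith+
    then obtain K where K: "real K \<le> 4 * R / (3 / 64 * \<epsilon>) + 2" "err K \<le> \<epsilon>"
      using early_small_error_of_gap_bound[of "3 / 64" \<epsilon> R err \<Phi>] drop gap assms
      by (auto simp: R_def)
    have "1 / 4 \<le> L * (1 / \<epsilon>) * real d"
      using mult_mono[OF mult_mono[OF L_ge half] d] L_ge assms by simp
    moreover have "4 * R / (3 / 64 * \<epsilon>) = 512 / 3 * (L * (1 / \<epsilon>) * real d)"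
      by (simp add: R_def)
    ultimately have "real K \<le> 200 * (L * (1 / \<epsilon>) * real d)" using K by linarith
    then show ?thesis using K False by (auto simp: balanced_iff min_def)
  qed
qed

end

section \<open>Operation count\<close>

lemma run_charge [simp]: "run_state (charge x) (w, r) = (x, (Suc w, r))"
  by (simp add: charge_def)

lemma run_scaled_sum_c:
  "run_state (scaled_sum_c u es) (w, r)
    = (\<Sum>(i, j, a)\<leftarrow>es. a * exp (u $ i - u $ j), (w + 4 * length es, r))"
  by (induction u es arbitrary: w r rule: scaled_sum_c.induct)
    (auto simp: add_c_def sub_c_def mul_c_def exp_c_def mult.commute)

lemma sum_list_filtered_comprehension:
  fixes f :: "'b \<Rightarrow> 'c::comm_monoid_add"
  shows "sum_list (map f (concat (map (\<lambda>i. if P i then [h i] else []) xs)))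
    = (\<Sum>i\<leftarrow>xs. if P i then f (h i) else 0)"
  by (induction xs) auto

lemma sum_row_entries:
  "sum_list (map f (row_entries A j))
    = (\<Sum>i<dim_col A. if A $$ (j, i) \<noteq> 0 then f (j, i, A $$ (j, i)) else 0)"
  by (simp only: row_entries_def sum_list_filtered_comprehension)
    (simp add: interv_sum_list_conv_sum_set_nat lessThan_atLeast0)

lemma sum_col_entries:
  "sum_list (map f (col_entries A j))
    = (\<Sum>i<dim_row A. if A $$ (i, j) \<noteq> 0 then f (i, j, A $$ (i, j)) else 0)"
  by (simp only: col_entries_def sum_list_filtered_comprehension)
    (simp add: interv_sum_list_conv_sum_set_nat lessThan_atLeast0)

lemma length_eq_sum_list: "length xs = (\<Sum>x\<leftarrow>xs. 1)"
  by (induction xs) auto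

lemma card_nonzero_entries:
  "card (nonzero_entries A)
    = (\<Sum>i<dim_row A. \<Sum>j<dim_col A. if A $$ (i, j) \<noteq> 0 then 1 else 0)"
proof -
  have "nonzero_entries A = {p \<in> {..<dim_row A} \<times> {..<dim_col A}. A $$ p \<noteq> 0}"
    by (auto simp: nonzero_entries_def)
  also have "card \<dots> = (\<Sum>p\<in>{..<dim_row A} \<times> {..<dim_col A}. if A $$ p \<noteq> 0 then 1 else 0)"
    by (simp add: card_eq_sum sum.inter_filter del: sum_constant One_nat_def)
  finally show ?thesis by (simp add: sum.cartesian_product case_prod_unfold)
qed

lemma sum_length_row_entries:
  "(\<Sum>j<dim_row A. length (row_entries A j)) = card (nonzero_entries A)"
  unfolding length_eq_sum_list sum_row_entries card_nonzero_entries ..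

lemma sum_length_col_entries:
  "(\<Sum>j<dim_col A. length (col_entries A j)) = card (nonzero_entries A)"
  unfolding length_eq_sum_list sum_col_entries card_nonzero_entries by (rule sum.swap)

context colored_matrix
begin

definition coord_cost :: "nat \<Rightarrow> nat" where
  "coord_cost j = 4 * (length (row_entries A j) + length (col_entries A j)) + 6"

definition cycle_cost :: nat where "cycle_cost = 8 * card (nonzero_entries A) + 6 * n"

lemma sum_coord_cost: "(\<Sum>j<n. coord_cost j) = cycle_cost"
  using sum_length_row_entries[of A] sum_length_col_entries[of A]
  by (simp add: coord_cost_def cycle_cost_def sum.distrib flip: sum_distrib_left)

lemma row_entries_row_sum:
  assumes "j < n"
  shows "(\<Sum>(i, j, a)\<leftarrow>row_entries A j. a * exp (x $ i - x $ j)) = row_sum A x j"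
  unfolding row_sum_eq[OF A assms] outflow_def entry_def sum_row_entries dims
  by (intro sum.cong) auto

lemma col_entries_col_sum:
  assumes "j < n"
  shows "(\<Sum>(i, j, a)\<leftarrow>col_entries A j. a * exp (x $ i - x $ j)) = col_sum A x j"
  unfolding col_sum_eq[OF A assms] inflow_def entry_def sum_col_entries dims
  by (intro sum.cong) auto

lemma run_new_coord_c:
  assumes "j < n"
  shows "run_state (new_coord_c (row_entries A) (col_entries A) x j) (w, r)
    = (x $ j + ln (col_sum A x j) / 2 - ln (row_sum A x j) / 2, (w + coord_cost j, r))"
  using row_entries_row_sum[OF assms, of x] col_entries_col_sum[OF assms, of x]
  by (simp add: new_coord_c_def run_scaled_sum_c ln_c_def div_c_def add_c_def sub_c_def coord_cost_def)

lemma run_new_coords_c: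
  assumes "set js \<subseteq> {..<n}"
  shows "run_state (new_coords_c (row_entries A) (col_entries A) x js) (w, r)
    = (map (\<lambda>j. (j, x $ j + ln (col_sum A x j) / 2 - ln (row_sum A x j) / 2)) js,
       (w + (\<Sum>j\<leftarrow>js. coord_cost j), r))"
  using assms by (induction js arbitrary: w) (auto simp: run_new_coord_c)

lemma run_block_round_c:
  assumes "S \<subseteq> {..<n}" "dim_vec x = n"
  shows "run_state (block_round_c (row_entries A) (col_entries A) (sorted_list_of_set S) x) (w, r)
    = (block_update A S x, (w + (\<Sum>j\<in>S. coord_cost j), Suc r))"
proof -
  have S: "finite S" using assms(1) finite_subset by blast
  then have "(\<Sum>j\<leftarrow>sorted_list_of_set S. coord_cost j) = (\<Sum>j\<in>S. coord_cost j)"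
    by (simp add: sum_list_distinct_conv_sum_set)
  then show ?thesis
    using S assms
    by (auto simp: block_round_c_def new_round_def run_new_coords_c block_update_def
        map_of_map_restrict restrict_map_def intro!: eq_vecI)
qed

lemma run_cycle_c:
  assumes "\<And>S. S \<in> set Ts \<Longrightarrow> S \<subseteq> {..<n}" "dim_vec x = n"
  shows "run_state (cycle_c (row_entries A) (col_entries A) (map sorted_list_of_set Ts) x) (w, r)
    = (fold (block_update A) Ts x, (w + (\<Sum>S\<leftarrow>Ts. \<Sum>j\<in>S. coord_cost j), r + length Ts))"
  using assms
proof (induction Ts arbitrary: x w r)
  case (Cons S Ts)
  have "dim_vec (block_update A S x) = n" by (simp add: block_update_def)
  then show ?case using Cons by (simp add: run_block_round_c)
qed simp

lemma sum_over_blocks: "(\<Sum>S\<leftarrow>Ss. \<Sum>j\<in>S. coord_cost j) = cycle_cost"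
proof -
  have "distinct Ss" and dis: "disjoint (set Ss)"
    using coloring by (auto simp: is_coloring_def partition_on_def)
  then have "(\<Sum>S\<leftarrow>Ss. \<Sum>j\<in>S. coord_cost j) = (\<Sum>S\<in>set Ss. \<Sum>j\<in>S. coord_cost j)"
    by (simp add: sum_list_distinct_conv_sum_set)
  also have "\<dots> = (\<Sum>j\<in>\<Union> (set Ss). coord_cost j)"
  proof (rule sum.Union_disjoint[unfolded comp_def, symmetric])
    show "\<forall>S\<in>set Ss. finite S"
      using blocks_cover by (metis Union_upper finite_lessThan finite_subset)
    show "\<forall>S\<in>set Ss. \<forall>T\<in>set Ss. S \<noteq> T \<longrightarrow> S \<inter> T = {}"
      using dis by (meson disjointD)
  qed
  finally show ?thesis by (simp add: blocks_cover sum_coord_cost)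
qed

lemma dim_fold_block_update: "dim_vec x = n \<Longrightarrow> dim_vec (fold (block_update A) Ts x) = n"
  by (induction Ts arbitrary: x) (auto simp: block_update_def)

lemma dim_osborne: "dim_vec (osborne A Ss t) = n"
proof (induction t)
  case (Suc t)
  then show ?case by (simp add: osborne_Suc osborne_cycle_def dim_fold_block_update)
qed (simp add: osborne_def)

lemma run_parallel_osborne_c:
  "run_state (parallel_osborne_c A Ss t) (0, 0) = (osborne A Ss t, (t * cycle_cost, t * length Ss))"
proof (induction t)
  case 0
  then show ?case by (simp add: parallel_osborne_c_def osborne_def)
next
  case (Suc t)
  have "S \<subseteq> {..<n}" if "S \<in> set Ss" for S using that blocks_cover by auto
  then have "run_state (cycle_c (row_entries A) (col_entries A) (map sorted_list_of_set Ss)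
        (osborne A Ss t)) (w, r)
      = (osborne A Ss (Suc t), (w + cycle_cost, r + length Ss))" for w r
    by (subst run_cycle_c) (auto simp: dim_osborne osborne_Suc osborne_cycle_def sum_over_blocks)
  then show ?case using Suc by (simp add: parallel_osborne_c_def add.commute)
qed

text \<open>
  Every row has a nonzero entry.  This bounds the part of the work that is proportional to the number of
  vertices by the number of arcs.
\<close>

lemma n_le_nonzero: "n \<le> card (nonzero_entries A)"
proof -
  have "(\<Sum>i<n. 1) \<le> (\<Sum>i<n. \<Sum>j<n. if A $$ (i, j) \<noteq> 0 then 1 else 0 :: nat)"
  proof (intro sum_mono)
    fix i assume "i \<in> {..<n}"
    then obtain j where j: "j < n" "A $$ (i, j) \<noteq> 0" using out_arc by auto
    then show "1 \<le> (\<Sum>j<n. if A $$ (i, j) \<noteq> 0 then 1 else 0 :: nat)"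
      using member_le_sum[of j "{..<n}" "\<lambda>j. if A $$ (i, j) \<noteq> 0 then 1 else 0 :: nat"] by simp
  qed
  then show ?thesis by (simp add: card_nonzero_entries)
qed

lemma cycle_cost_le: "cycle_cost \<le> 14 * card (nonzero_entries A)"
  using n_le_nonzero by (simp add: cycle_cost_def)

end

theorem corollary2:
  "\<exists>C::real. C > 0 \<and>
    (\<forall>(n::nat) (A::real mat) (\<epsilon>::real) (Ss::nat set list).
       n \<ge> 2 \<longrightarrow> A \<in> carrier_mat n n \<longrightarrow>
       (\<forall>i<n. \<forall>j<n. A $$ (i, j) \<ge> 0) \<longrightarrow> (\<forall>i<n. A $$ (i, i) = 0) \<longrightarrow>
       balanceable A \<longrightarrow> \<epsilon> > 0 \<longrightarrow> is_coloring Ss A \<longrightarrow>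
       (\<exists>K work rounds :: nat.
          real K \<le> C * (ln (kappa A) / \<epsilon> *
            min (1 / \<epsilon>) (real (graph_diameter (with_proj (mat_graph A))))) \<and>
          eps_balances \<epsilon> (osborne A Ss K) A \<and>
          run_state (parallel_osborne_c A Ss K) (0, 0) = (osborne A Ss K, (work, rounds)) \<and>
          real work \<le> C * (real (card (nonzero_entries A)) * real K) \<and>
          real rounds \<le> C * (real (length Ss) * real K)))"
proof (intro exI[of _ "200 :: real"] conjI allI impI)
  fix n :: nat and A :: "real mat" and \<epsilon> :: real and Ss :: "nat set list"
  assume "2 \<le> n" "A \<in> carrier_mat n n" "\<forall>i<n. \<forall>j<n. A $$ (i, j) \<ge> 0"
    "balanceable A" "is_coloring Ss A" and \<epsilon>: "\<epsilon> > 0"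
  then interpret colored_matrix n A Ss
    by unfold_locales auto
  obtain K where K: "real K \<le> 200 * (L / \<epsilon> * min (1 / \<epsilon>) (real d))"
      "eps_balances \<epsilon> (osborne A Ss K) A"
    using few_cycles[OF \<epsilon>] by auto
  have "real (K * cycle_cost) \<le> real (K * (14 * card (nonzero_entries A)))"
    using cycle_cost_le by (intro of_nat_mono mult_left_mono) auto
  also have "\<dots> \<le> 200 * (real (card (nonzero_entries A)) * real K)" by simp
  finally have work: "real (K * cycle_cost) \<le> 200 * (real (card (nonzero_entries A)) * real K)" .
  have rounds: "real (K * length Ss) \<le> 200 * (real (length Ss) * real K)" by simp
  show "\<exists>K work rounds :: nat.
          real K \<le> 200 * (ln (kappa A) / \<epsilon> *
            min (1 / \<epsilon>) (real (graph_diameter (with_proj (mat_graph A))))) \<and>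
          eps_balances \<epsilon> (osborne A Ss K) A \<and>
          run_state (parallel_osborne_c A Ss K) (0, 0) = (osborne A Ss K, (work, rounds)) \<and>
          real work \<le> 200 * (real (card (nonzero_entries A)) * real K) \<and>
          real rounds \<le> 200 * (real (length Ss) * real K)"
    using K run_parallel_osborne_c work rounds unfolding L_def d_def by blast
qed simp

end
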